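(* Let $\mathbf y\in\mathbb R^n$, $w^{(1)}\in\mathbb R_{\ge0}^n$, $w^{(2)}\in\mathbb R_{>0}^n$, $c_1,c_2\in\mathbb R$. For $\boldsymbol\lambda=(\lambda_1,\lambda_2)$ and $j\in\{1,2\}$ let $h^{(j)}(\boldsymbol\lambda)=\sum_{i=1}^n h^{(j)}_i(\boldsymbol\lambda)$ with $h^{(j)}_i(\boldsymbol\lambda)=w^{(j)}_i$ if $\lambda_1w^{(1)}_i+\lambda_2w^{(2)}_i<y_i-1$, $=-w^{(j)}_i$ if $\lambda_1w^{(1)}_i+\lambda_2w^{(2)}_i>y_i+1$, and $=w^{(j)}_i(y_i-\lambda_1w^{(1)}_i-\lambda_2w^{(2)}_i)$ otherwise. A solution is a $\boldsymbol\lambda$ with $h^{(1)}(\boldsymbol\lambda)=c_1$, $h^{(2)}(\boldsymbol\lambda)=c_2$. Let the boundary lines be $y_i-\lambda_1w^{(1)}_i-\lambda_2w^{(2)}_i=\pm1$, $i\in[n]$. Suppose $\lambda_1^l<\lambda_1^r$ are such that there exists a solution $\boldsymbol\lambda^\dagger$ with $\lambda_1^\dagger\in(\lambda_1^l,\lambda_1^r)$ and no intersection point of boundary lines has $\lambda_1$-coordinate in $(\lambda_1^l,\lambda_1^r)$. Then a solution $\boldsymbol\lambda^*$ can be found in $O(n\log n)$ time.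
   Context: A solution $(\lambda_1,\lambda_2)$ yields the Euclidean projection of $\mathbf y$ onto $[-1,1]^n\cap\{\mathbf x:\sum_iw^{(1)}_ix_i=c_1,\ \sum_iw^{(2)}_ix_i=c_2\}$ via $x_i=[\,y_i-\lambda_1w^{(1)}_i-\lambda_2w^{(2)}_i\,]$, $[z]=\min(1,\max(-1,z))$. *)

theory Defs
  imports Complex_Main "HOL-Library.Landau_Symbols"
begin

section \<open>The piecewise linear system\<close>

text \<open>Vectors are functions on indices \<open>i < n\<close>; \<open>w j i\<close> stands for \<open>w\<close> with superscript
  \<open>j \<in> {1, 2}\<close> and subscript \<open>i\<close>.\<close>

definition lin :: "(nat \<Rightarrow> nat \<Rightarrow> real) \<Rightarrow> nat \<Rightarrow> real \<times> real \<Rightarrow> real" where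
  "lin w i lam = fst lam * w 1 i + snd lam * w 2 i"

definition h_comp ::
  "(nat \<Rightarrow> real) \<Rightarrow> (nat \<Rightarrow> nat \<Rightarrow> real) \<Rightarrow> nat \<Rightarrow> nat \<Rightarrow> real \<times> real \<Rightarrow> real" where
  "h_comp y w j i lam =
    (if lin w i lam < y i - 1 then w j i
     else if lin w i lam > y i + 1 then - w j i
     else w j i * (y i - fst lam * w 1 i - snd lam * w 2 i))"

definition h ::
  "nat \<Rightarrow> (nat \<Rightarrow> real) \<Rightarrow> (nat \<Rightarrow> nat \<Rightarrow> real) \<Rightarrow> nat \<Rightarrow> real \<times> real \<Rightarrow> real" where
  "h n y w j lam = (\<Sum>i<n. h_comp y w j i lam)"

definition is_solution ::
  "nat \<Rightarrow> (nat \<Rightarrow> real) \<Rightarrow> (nat \<Rightarrow> nat \<Rightarrow> real) \<Rightarrow> real \<Rightarrow> real \<Rightarrow> real \<times> real \<Rightarrow> bool" where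
  "is_solution n y w c1 c2 lam \<longleftrightarrow> h n y w 1 lam = c1 \<and> h n y w 2 lam = c2"

definition boundary_lines ::
  "nat \<Rightarrow> (nat \<Rightarrow> real) \<Rightarrow> (nat \<Rightarrow> nat \<Rightarrow> real) \<Rightarrow> (real \<times> real) set set" where
  "boundary_lines n y w =
    {{lam. y i - fst lam * w 1 i - snd lam * w 2 i = b} | i b. i < n \<and> b \<in> {1, -1}}"

text \<open>Lines are compared as point sets: coinciding boundary lines that arise from different
  indices or signs are one line and do not create intersection points.\<close>

definition intersection_point ::
  "nat \<Rightarrow> (nat \<Rightarrow> real) \<Rightarrow> (nat \<Rightarrow> nat \<Rightarrow> real) \<Rightarrow> real \<times> real \<Rightarrow> bool" where
  "intersection_point n y w p \<longleftrightarrow>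
    (\<exists>L\<in>boundary_lines n y w. \<exists>M\<in>boundary_lines n y w. L \<noteq> M \<and> p \<in> L \<and> p \<in> M)"


section \<open>A unit-cost real RAM\<close>

text \<open>
  Running time is measured on the usual real RAM, presented as a structured while language.
  Memory consists of natural-number and real scalars and arrays, addressed by name and, for
  arrays, by a natural number that may be computed at run time. Every constant, memory access,
  arithmetic operation, comparison, Boolean connective and command costs one time unit.

  Reals are exact, with the four field operations and comparison, but without rounding and
  without conversion to natural numbers. Natural numbers serve as counters and addresses and
  have only addition and truncated subtraction. Hence unit cost cannot be exploited by packing
  data into large numbers. Literals in a program are natural numbers and integers. Division by
  zero yields zero, as in HOL; a zero test would achieve the same in constant time.
\<close>

type_synonym vname = string

record state =
  nvar :: "vname \<Rightarrow> nat"
  narr :: "vname \<Rightarrow> nat \<Rightarrow> nat"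
  rvar :: "vname \<Rightarrow> real"
  rarr :: "vname \<Rightarrow> nat \<Rightarrow> real"

datatype nexp =
    NConst nat | NVar vname | NArr vname nexp
  | NAdd nexp nexp | NSub nexp nexp

datatype rexp =
    RConst int | RVar vname | RArr vname nexp
  | RAdd rexp rexp | RSub rexp rexp | RMul rexp rexp | RDiv rexp rexp

datatype bexp =
    NLess nexp nexp | RLess rexp rexp | BNot bexp | BAnd bexp bexp

datatype com =
    Skip
  | NAssign vname nexp
  | NStore vname nexp nexp
  | RAssign vname rexp
  | RStore vname nexp rexp
  | Seq com com
  | Cond bexp com com
  | While bexp com

fun nval :: "nexp \<Rightarrow> state \<Rightarrow> nat" where
  "nval (NConst k) s = k"
| "nval (NVar x) s = nvar s x"
| "nval (NArr a e) s = narr s a (nval e s)"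
| "nval (NAdd e f) s = nval e s + nval f s"
| "nval (NSub e f) s = nval e s - nval f s"

fun ncost :: "nexp \<Rightarrow> nat" where
  "ncost (NConst k) = 1"
| "ncost (NVar x) = 1"
| "ncost (NArr a e) = 1 + ncost e"
| "ncost (NAdd e f) = 1 + ncost e + ncost f"
| "ncost (NSub e f) = 1 + ncost e + ncost f"

fun rval :: "rexp \<Rightarrow> state \<Rightarrow> real" where
  "rval (RConst k) s = of_int k"
| "rval (RVar x) s = rvar s x"
| "rval (RArr a e) s = rarr s a (nval e s)"
| "rval (RAdd e f) s = rval e s + rval f s"
| "rval (RSub e f) s = rval e s - rval f s"
| "rval (RMul e f) s = rval e s * rval f s"
| "rval (RDiv e f) s = rval e s / rval f s"

fun rcost :: "rexp \<Rightarrow> nat" where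
  "rcost (RConst k) = 1"
| "rcost (RVar x) = 1"
| "rcost (RArr a e) = 1 + ncost e"
| "rcost (RAdd e f) = 1 + rcost e + rcost f"
| "rcost (RSub e f) = 1 + rcost e + rcost f"
| "rcost (RMul e f) = 1 + rcost e + rcost f"
| "rcost (RDiv e f) = 1 + rcost e + rcost f"

fun bval :: "bexp \<Rightarrow> state \<Rightarrow> bool" where
  "bval (NLess e f) s \<longleftrightarrow> nval e s < nval f s"
| "bval (RLess e f) s \<longleftrightarrow> rval e s < rval f s"
| "bval (BNot b) s \<longleftrightarrow> \<not> bval b s"
| "bval (BAnd b c) s \<longleftrightarrow> bval b s \<and> bval c s"

fun bcost :: "bexp \<Rightarrow> nat" where
  "bcost (NLess e f) = 1 + ncost e + ncost f"
| "bcost (RLess e f) = 1 + rcost e + rcost f"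
| "bcost (BNot b) = 1 + bcost b"
| "bcost (BAnd b c) = 1 + bcost b + bcost c"

text \<open>\<open>exec P s t s'\<close>: started in \<open>s\<close>, program \<open>P\<close> halts in \<open>s'\<close> after exactly \<open>t\<close> time units.\<close>

inductive exec :: "com \<Rightarrow> state \<Rightarrow> nat \<Rightarrow> state \<Rightarrow> bool" where
  Skip: "exec Skip s 1 s"
| NAssign: "exec (NAssign x e) s (1 + ncost e) (s\<lparr>nvar := (nvar s)(x := nval e s)\<rparr>)"
| NStore: "exec (NStore a i e) s (1 + ncost i + ncost e)
    (s\<lparr>narr := (narr s)(a := (narr s a)(nval i s := nval e s))\<rparr>)"
| RAssign: "exec (RAssign x e) s (1 + rcost e) (s\<lparr>rvar := (rvar s)(x := rval e s)\<rparr>)"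
| RStore: "exec (RStore a i e) s (1 + ncost i + rcost e)
    (s\<lparr>rarr := (rarr s)(a := (rarr s a)(nval i s := rval e s))\<rparr>)"
| Seq: "exec P s t s' \<Longrightarrow> exec Q s' t' s'' \<Longrightarrow> exec (Seq P Q) s (1 + t + t') s''"
| CondTrue: "bval b s \<Longrightarrow> exec P s t s' \<Longrightarrow> exec (Cond b P Q) s (1 + bcost b + t) s'"
| CondFalse: "\<not> bval b s \<Longrightarrow> exec Q s t s' \<Longrightarrow> exec (Cond b P Q) s (1 + bcost b + t) s'"
| WhileFalse: "\<not> bval b s \<Longrightarrow> exec (While b P) s (1 + bcost b) s"
| WhileTrue: "bval b s \<Longrightarrow> exec P s t s' \<Longrightarrow> exec (While b P) s' t' s'' \<Longrightarrow>
    exec (While b P) s (1 + bcost b + t + t') s''"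

inductive_cases exec_SkipE: "exec Skip s t s'"
inductive_cases exec_NAssignE: "exec (NAssign x e) s t s'"
inductive_cases exec_NStoreE: "exec (NStore a i e) s t s'"
inductive_cases exec_RAssignE: "exec (RAssign x e) s t s'"
inductive_cases exec_RStoreE: "exec (RStore a i e) s t s'"
inductive_cases exec_SeqE: "exec (Seq P Q) s t s'"
inductive_cases exec_CondE: "exec (Cond b P Q) s t s'"
inductive_cases exec_WhileE: "exec (While b P) s t s'"

lemma exec_deterministic: "exec P s t s' \<Longrightarrow> exec P s u s'' \<Longrightarrow> t = u \<and> s' = s''"
proof (induction arbitrary: u s'' rule: exec.induct)
  case Skip then show ?case by (auto elim: exec_SkipE)
next
  case NAssign then show ?case by (auto elim: exec_NAssignE)
next
  case NStore then show ?case by (auto elim: exec_NStoreE)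
next
  case RAssign then show ?case by (auto elim: exec_RAssignE)
next
  case RStore then show ?case by (auto elim: exec_RStoreE)
next
  case (Seq P s t s' Q t' s3)
  from Seq.prems show ?case
    by (rule exec_SeqE) (metis Seq.IH plus_1_eq_Suc add_Suc)
next
  case (CondTrue b s P t s' Q)
  from CondTrue.prems show ?case
    by (rule exec_CondE) (metis CondTrue.hyps(1) CondTrue.IH plus_1_eq_Suc add_Suc)+
next
  case (CondFalse b s Q t s' P)
  from CondFalse.prems show ?case
    by (rule exec_CondE) (metis CondFalse.hyps(1) CondFalse.IH plus_1_eq_Suc add_Suc)+
next
  case (WhileFalse b s P)
  from WhileFalse.prems show ?case
    by (rule exec_WhileE) (use WhileFalse.hyps in simp_all)
next
  case (WhileTrue b s P t s' t' s3)
  from WhileTrue.prems show ?case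
    by (rule exec_WhileE) (metis WhileTrue.hyps(1) WhileTrue.IH plus_1_eq_Suc add_Suc)+
qed

text \<open>The instance is read from the memory cells below; all other cells are zero.\<close>

definition input_state ::
  "nat \<Rightarrow> (nat \<Rightarrow> real) \<Rightarrow> (nat \<Rightarrow> nat \<Rightarrow> real) \<Rightarrow> real \<Rightarrow> real \<Rightarrow> real \<Rightarrow> real \<Rightarrow> state" where
  "input_state n y w c1 c2 l r =
    \<lparr>nvar = (\<lambda>_. 0)(''n'' := n),
     narr = (\<lambda>_ _. 0),
     rvar = (\<lambda>_. 0)(''c1'' := c1, ''c2'' := c2, ''l'' := l, ''r'' := r),
     rarr = (\<lambda>_ _. 0)
       (''y'' := (\<lambda>i. if i < n then y i else 0),
        ''w1'' := (\<lambda>i. if i < n then w 1 i else 0),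
        ''w2'' := (\<lambda>i. if i < n then w 2 i else 0))\<rparr>"

definition result :: "state \<Rightarrow> real \<times> real" where
  "result s = (rvar s ''lambda1'', rvar s ''lambda2'')"

end

theory Submission
  imports Defs "HOL-Library.Multiset"
begin

text \<open>
  Inside the strip no two distinct boundary lines meet, so sorting the \<open>2n\<close> lines by their height over
  the midpoint of \<open>(l, r)\<close> orders them over the whole closed strip. Between two consecutive lines
  \<open>h\<close> is affine, and crossing a line changes its coefficients by a single term. A sweep over the
  sorted lines therefore has the \<open>2\<times>2\<close> linear system of every region available in constant time,
  and in constant time it decides whether that system has a solution in the region. Below the lowest
  and above the highest line \<open>h\<close> is constant along vertical lines, so some bounded region contains a
  solution. Sorting by bottom-up merge sort dominates the running time.
\<close>

section \<open>Running programs\<close>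

text \<open>Dividing by \<open>w 2 i\<close> turns the boundary lines of index \<open>i\<close> into
  graphs over the first coordinate, and the clamp splits into two hinges that bend exactly on these
  graphs. So every line carries one signed weight, and the matrix of a region is symmetric: it
  consists of the weighted moments of the slopes of orders 2, 1 and 0. The obstacle is a singular
  matrix, where Cramer's rule yields nothing and the solutions fill a segment or a whole region. The
  order 0 moment \<open>C\<close> separates the two cases: it is the sum of the squares of
  \<open>w 2 i\<close> over the indices whose lines enclose the region. If it vanishes, there are no
  such indices and the entire matrix is zero; otherwise the second equation expresses the second
  coordinate through the first, and an interval problem in one variable remains. Either way a single
  candidate settles a region: if the region has a solution at all, the candidate is one.\<close>

definition run :: "com \<Rightarrow> state \<Rightarrow> (nat \<Rightarrow> state \<Rightarrow> bool) \<Rightarrow> bool" where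
  "run P s Q \<longleftrightarrow> (\<exists>t s'. exec P s t s' \<and> Q t s')"

lemma run_mono: "run P s Q \<Longrightarrow> (\<And>t s'. Q t s' \<Longrightarrow> R t s') \<Longrightarrow> run P s R"
  unfolding run_def by blast

text \<open>Determinism makes the existential in \<open>run\<close> harmless. The rules below can
  therefore be equivalences, and the simplifier executes straight-line code symbolically, cost
  included.\<close>

lemma run_exec: "exec P s t s' \<Longrightarrow> run P s Q \<longleftrightarrow> Q t s'"
  unfolding run_def using exec_deterministic by blast

lemma run_basic [simp]:
  "run Skip s Q \<longleftrightarrow> Q 1 s"
  "run (NAssign x e) s Q \<longleftrightarrow> Q (1 + ncost e) (s\<lparr>nvar := (nvar s)(x := nval e s)\<rparr>)"
  "run (NStore a i e) s Q \<longleftrightarrow> Q (1 + ncost i + ncost e)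
    (s\<lparr>narr := (narr s)(a := (narr s a)(nval i s := nval e s))\<rparr>)"
  "run (RAssign x f) s Q \<longleftrightarrow> Q (1 + rcost f) (s\<lparr>rvar := (rvar s)(x := rval f s)\<rparr>)"
  "run (RStore a i f) s Q \<longleftrightarrow> Q (1 + ncost i + rcost f)
    (s\<lparr>rarr := (rarr s)(a := (rarr s a)(nval i s := rval f s))\<rparr>)"
  by (rule run_exec, rule exec.intros)+

lemma run_Seq [simp]:
  "run (Seq P1 P2) s Q \<longleftrightarrow> run P1 s (\<lambda>t s'. run P2 s' (\<lambda>t' s''. Q (1 + t + t') s''))"
proof
  assume "run (Seq P1 P2) s Q"
  then show "run P1 s (\<lambda>t s'. run P2 s' (\<lambda>t' s''. Q (1 + t + t') s''))"
    unfolding run_def by (fastforce elim: exec_SeqE)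
next
  assume "run P1 s (\<lambda>t s'. run P2 s' (\<lambda>t' s''. Q (1 + t + t') s''))"
  then show "run (Seq P1 P2) s Q"
    unfolding run_def using exec.Seq by blast
qed

lemma run_SeqI:
  "run P1 s Q1 \<Longrightarrow> (\<And>t s'. Q1 t s' \<Longrightarrow> run P2 s' (\<lambda>t' s''. Q (1 + t + t') s'')) \<Longrightarrow> run (Seq P1 P2) s Q"
  by (auto elim: run_mono)

lemma run_Cond [simp]:
  "run (Cond b P1 P2) s Q \<longleftrightarrow>
    (bval b s \<longrightarrow> run P1 s (\<lambda>t. Q (1 + bcost b + t))) \<and>
    (\<not> bval b s \<longrightarrow> run P2 s (\<lambda>t. Q (1 + bcost b + t)))"
proof
  assume "run (Cond b P1 P2) s Q"
  then show "(bval b s \<longrightarrow> run P1 s (\<lambda>t. Q (1 + bcost b + t))) \<and>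
    (\<not> bval b s \<longrightarrow> run P2 s (\<lambda>t. Q (1 + bcost b + t)))"
    unfolding run_def by (fastforce elim: exec_CondE)
next
  assume "(bval b s \<longrightarrow> run P1 s (\<lambda>t. Q (1 + bcost b + t))) \<and>
    (\<not> bval b s \<longrightarrow> run P2 s (\<lambda>t. Q (1 + bcost b + t)))"
  then show "run (Cond b P1 P2) s Q"
    unfolding run_def using exec.CondTrue exec.CondFalse by blast
qed

text \<open>The number \<open>c\<close> is a potential, a budget for the remaining time: each round
  pays for its body and its test out of it. The budget drops strictly, which gives termination by
  induction; the extra \<open>1 + bcost b\<close> in the conclusion is the final failing
  test.\<close>

lemma run_While:
  assumes "I c s"
    and step: "\<And>c s. I c s \<Longrightarrow> bval b s \<Longrightarrow>
      run P s (\<lambda>t s'. \<exists>c'. I c' s' \<and> c' + t + 1 + bcost b \<le> c)"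
  shows "run (While b P) s (\<lambda>t s'. (\<exists>c'. I c' s') \<and> \<not> bval b s' \<and> t \<le> c + 1 + bcost b)"
  using assms(1)
proof (induction c arbitrary: s rule: less_induct)
  case (less c)
  show ?case
  proof (cases "bval b s")
    case False
    with exec.WhileFalse[OF False, of P] less.prems show ?thesis
      unfolding run_def by (intro exI[of _ "1 + bcost b"] exI[of _ s]) auto
  next
    case True
    with step less.prems obtain t s' c' where 1: "exec P s t s'" "I c' s'" "c' + t + 1 + bcost b \<le> c"
      unfolding run_def by blast
    then have "c' < c" by simp
    from less.IH[OF this 1(2)] obtain t' s'' where 2: "exec (While b P) s' t' s''"
      "\<exists>c'. I c' s''" "\<not> bval b s''" "t' \<le> c' + 1 + bcost b"
      unfolding run_def by blast
    have "exec (While b P) s (1 + bcost b + t + t') s''"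
      by (rule exec.WhileTrue[OF True 1(1) 2(1)])
    then show ?thesis
      unfolding run_def using 1 2 by (intro exI[of _ "1 + bcost b + t + t'"] exI[of _ s'']) auto
  qed
qed

lemma run_While_count:
  assumes I: "I m s"
    and step: "\<And>m s. I m s \<Longrightarrow> bval b s \<Longrightarrow> 0 < m \<and> run P s (\<lambda>t s'. t \<le> T \<and> I (m - 1) s')"
  shows "run (While b P) s
    (\<lambda>t s'. (\<exists>m'. I m' s') \<and> \<not> bval b s' \<and> t \<le> m * (T + 1 + bcost b) + 1 + bcost b)"
proof -
  define J where "J c s \<longleftrightarrow> (\<exists>m. I m s \<and> c = m * (T + 1 + bcost b))" for c s
  have "run (While b P) s
      (\<lambda>t s'. (\<exists>c. J c s') \<and> \<not> bval b s' \<and> t \<le> m * (T + 1 + bcost b) + 1 + bcost b)"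
  proof (rule run_While)
    show "J (m * (T + 1 + bcost b)) s" using I unfolding J_def by blast
    fix c s assume "J c s" "bval b s"
    then obtain m where m: "I m s" "c = m * (T + 1 + bcost b)" unfolding J_def by blast
    from step[OF m(1) \<open>bval b s\<close>] have "0 < m" and run: "run P s (\<lambda>t s'. t \<le> T \<and> I (m - 1) s')"
      by auto
    then obtain k where k: "m = Suc k" by (cases m) auto
    from run show "run P s (\<lambda>t s'. \<exists>c'. J c' s' \<and> c' + t + 1 + bcost b \<le> c)"
    proof (rule run_mono)
      fix t s' assume t: "t \<le> T \<and> I (m - 1) s'"
      then have "J (k * (T + 1 + bcost b)) s'" unfolding J_def k by auto
      moreover have "k * (T + 1 + bcost b) + t + 1 + bcost b \<le> c" using t unfolding m(2) k by simp
      ultimately show "\<exists>c'. J c' s' \<and> c' + t + 1 + bcost b \<le> c" by blast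
    qed
  qed
  then show ?thesis
    by (rule run_mono) (auto simp: J_def)
qed

text \<open>The frame condition of a program: \<open>X\<close> lists the names that it may
  overwrite.\<close>

definition agree_except :: "vname set \<Rightarrow> (vname \<Rightarrow> 'a) \<Rightarrow> (vname \<Rightarrow> 'a) \<Rightarrow> bool" where
  "agree_except X f g \<longleftrightarrow> (\<forall>v. v \<notin> X \<longrightarrow> f v = g v)"

lemma agree_except_refl [simp]: "agree_except X f f"
  by (simp add: agree_except_def)

lemma agree_except_upd [simp]: "x \<in> X \<Longrightarrow> agree_except X (f(x := c)) g \<longleftrightarrow> agree_except X f g"
  by (auto simp: agree_except_def)

lemma agree_exceptD: "agree_except X f g \<Longrightarrow> x \<notin> X \<Longrightarrow> f x = g x"
  by (simp add: agree_except_def)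

lemma agree_except_trans: "agree_except X f g \<Longrightarrow> agree_except Y g k \<Longrightarrow> X \<subseteq> Z \<Longrightarrow> Y \<subseteq> Z \<Longrightarrow> agree_except Z f k"
  unfolding agree_except_def by (metis subsetD)

section \<open>Merge sort\<close>

abbreviation slice :: "(nat \<Rightarrow> 'a) \<Rightarrow> nat \<Rightarrow> nat \<Rightarrow> 'a list" where
  "slice f i j \<equiv> map f [i..<j]"

text \<open>\<open>slice b lo k\<close> is the merged part; the rests of the two runs start at
  \<open>i\<close> and \<open>j\<close>. The equation \<open>k + mid = i + j\<close> counts the
  moved elements without truncated subtraction. Sortedness of the merged part followed by either
  rest says at once that all three lists are sorted and that the merged part is below both
  rests.\<close>

definition merge_inv :: "(nat \<Rightarrow> real) \<Rightarrow> (nat \<Rightarrow> nat) \<Rightarrow> (nat \<Rightarrow> nat) \<Rightarrow>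
    nat \<Rightarrow> nat \<Rightarrow> nat \<Rightarrow> nat \<Rightarrow> nat \<Rightarrow> nat \<Rightarrow> bool" where
  "merge_inv f a b lo mid hi i j k \<longleftrightarrow>
    lo \<le> i \<and> i \<le> mid \<and> mid \<le> j \<and> j \<le> hi \<and> k + mid = i + j \<and>
    mset (slice b lo k) + mset (slice a i mid) + mset (slice a j hi) = mset (slice a lo hi) \<and>
    sorted (map f (slice b lo k @ slice a i mid)) \<and>
    sorted (map f (slice b lo k @ slice a j hi))"

lemma merge_inv_init:
  assumes "lo \<le> mid" "mid \<le> hi" "sorted (map f (slice a lo mid))" "sorted (map f (slice a mid hi))"
  shows "merge_inv f a b lo mid hi lo mid lo"
proof -
  have "[lo..<hi] = [lo..<mid] @ [mid..<hi]"
    using assms(1,2) by (metis le_iff_add upt_add_eq_append)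
  then show ?thesis
    using assms unfolding merge_inv_def by simp
qed

text \<open>Comparison with the head of the right run suffices because that run is sorted; if it is
  exhausted, nothing needs to be compared.\<close>

lemma merge_inv_left:
  assumes "merge_inv f a b lo mid hi i j k" "i < mid" "j < hi \<Longrightarrow> f (a i) \<le> f (a j)"
  shows "merge_inv f a (b(k := a i)) lo mid hi (Suc i) j (Suc k)"
proof -
  have k: "lo \<le> k" using assms(1) unfolding merge_inv_def by linarith
  have b: "slice (b(k := a i)) lo (Suc k) = slice b lo k @ [a i]" using k by simp
  have i: "slice a i mid = a i # slice a (Suc i) mid" using assms(2) by (simp add: upt_conv_Cons)
  have "\<forall>x\<in>set (slice a j hi). f (a i) \<le> f x"
  proof (cases "j < hi")
    case True
    then have "slice a j hi = a j # slice a (Suc j) hi" by (simp add: upt_conv_Cons)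
    with assms(1) assms(3)[OF True] show ?thesis
      unfolding merge_inv_def by (fastforce simp: sorted_append)
  qed simp
  with assms(1,2) show ?thesis
    unfolding merge_inv_def b i by (auto simp: sorted_append simp del: upt_Suc)
qed

lemma merge_inv_right:
  assumes "merge_inv f a b lo mid hi i j k" "j < hi" "i < mid \<Longrightarrow> f (a j) \<le> f (a i)"
  shows "merge_inv f a (b(k := a j)) lo mid hi i (Suc j) (Suc k)"
proof -
  have k: "lo \<le> k" using assms(1) unfolding merge_inv_def by linarith
  have b: "slice (b(k := a j)) lo (Suc k) = slice b lo k @ [a j]" using k by simp
  have j: "slice a j hi = a j # slice a (Suc j) hi" using assms(2) by (simp add: upt_conv_Cons)
  have "\<forall>x\<in>set (slice a i mid). f (a j) \<le> f x"
  proof (cases "i < mid")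
    case True
    then have "slice a i mid = a i # slice a (Suc i) mid" by (simp add: upt_conv_Cons)
    with assms(1) assms(3)[OF True] show ?thesis
      unfolding merge_inv_def by (fastforce simp: sorted_append)
  qed simp
  with assms(1,2) show ?thesis
    unfolding merge_inv_def b j by (auto simp: sorted_append simp del: upt_Suc)
qed

text \<open>The counting equation with \<open>i \<le> mid\<close> and \<open>j \<le> hi\<close>
  forces both rests to be empty once \<open>k\<close> reaches \<open>hi\<close>.\<close>

lemma merge_inv_final:
  assumes "merge_inv f a b lo mid hi i j k" "\<not> k < hi"
  shows "mset (slice b lo hi) = mset (slice a lo hi)" "sorted (map f (slice b lo hi))"
proof -
  have "i = mid" "j = hi" "k = hi" using assms unfolding merge_inv_def by linarith+
  with assms(1) show "mset (slice b lo hi) = mset (slice a lo hi)" "sorted (map f (slice b lo hi))"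
    unfolding merge_inv_def by auto
qed

definition runs_sorted :: "(nat \<Rightarrow> real) \<Rightarrow> nat \<Rightarrow> nat \<Rightarrow> (nat \<Rightarrow> nat) \<Rightarrow> bool" where
  "runs_sorted f wd N a \<longleftrightarrow> (\<forall>m. sorted (map f (slice a (m * wd) (min (Suc m * wd) N))))"

text \<open>Here \<open>wd\<close> is the width of the blocks being produced, so the pass
  instantiates it with the doubled width. The position \<open>lo\<close> is a block border, capped
  at \<open>N\<close> after an incomplete last block.\<close>

definition pass_inv :: "(nat \<Rightarrow> real) \<Rightarrow> (nat \<Rightarrow> nat) \<Rightarrow> (nat \<Rightarrow> nat) \<Rightarrow> nat \<Rightarrow> nat \<Rightarrow> nat \<Rightarrow> bool" where
  "pass_inv f a b wd N lo \<longleftrightarrow>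
    (\<exists>m. lo = min (m * wd) N \<and> (\<forall>m'<m. sorted (map f (slice b (m' * wd) (min (Suc m' * wd) N))))) \<and>
    mset (slice b 0 lo) = mset (slice a 0 lo)"

lemma pass_inv_init: "pass_inv f a b wd N 0"
  unfolding pass_inv_def by (intro conjI exI[of _ 0]) auto

lemma pass_inv_step:
  assumes inv: "pass_inv f a b wd N lo" and "lo < N" and hi: "hi = min (lo + wd) N"
    and eq: "\<And>q. q < lo \<Longrightarrow> b' q = b q"
    and new: "mset (slice b' lo hi) = mset (slice a lo hi)" "sorted (map f (slice b' lo hi))"
  shows "pass_inv f a b' wd N hi"
proof -
  obtain m where "lo = min (m * wd) N"
    and m: "\<And>m'. m' < m \<Longrightarrow> sorted (map f (slice b (m' * wd) (min (Suc m' * wd) N)))"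
    using inv unfolding pass_inv_def by blast
  with \<open>lo < N\<close> have lo: "lo = m * wd" by simp
  have lohi: "lo \<le> hi" using hi \<open>lo < N\<close> by simp
  have hi': "hi = min (Suc m * wd) N" unfolding hi lo by (simp add: add.commute)
  have eqs: "slice b' i j = slice b i j" if "j \<le> lo" for i j
    using that by (intro map_cong refl eq) simp
  have sorted: "sorted (map f (slice b' (m' * wd) (min (Suc m' * wd) N)))" if "m' < Suc m" for m'
  proof (cases "m' = m")
    case True
    show ?thesis using new(2) unfolding True lo hi' .
  next
    case False
    then have "Suc m' \<le> m" using that by simp
    then have "Suc m' * wd \<le> lo" unfolding lo by (rule mult_right_mono) simp
    then have le: "min (Suc m' * wd) N \<le> lo" by simp
    show ?thesis unfolding eqs[OF le] by (rule m) (use False that in simp)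
  qed
  have mset: "mset (slice b' 0 hi) = mset (slice a 0 hi)"
  proof -
    have split: "[0..<hi] = [0..<lo] @ [lo..<hi]"
      using lohi by (metis le0 le_add_diff_inverse upt_add_eq_append)
    have "mset (slice b 0 lo) = mset (slice a 0 lo)"
      using inv unfolding pass_inv_def by blast
    then show ?thesis
      unfolding split map_append mset_append new(1) eqs[OF order.refl] by simp
  qed
  show ?thesis
    unfolding pass_inv_def
  proof (intro conjI exI[of _ "Suc m"] allI impI)
    show "hi = min (Suc m * wd) N" by (rule hi')
    show "mset (slice b' 0 hi) = mset (slice a 0 hi)" by (rule mset)
    show "sorted (map f (slice b' (m' * wd) (min (Suc m' * wd) N)))" if "m' < Suc m" for m'
      using that by (rule sorted)
  qed
qed

lemma pass_inv_final:
  assumes "pass_inv f a b wd N lo" "\<not> lo < N"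
  shows "runs_sorted f wd N b" "mset (slice b 0 N) = mset (slice a 0 N)"
proof -
  obtain m where m: "lo = min (m * wd) N" "\<And>m'. m' < m \<Longrightarrow> sorted (map f (slice b (m' * wd) (min (Suc m' * wd) N)))"
    "mset (slice b 0 lo) = mset (slice a 0 lo)"
    using assms unfolding pass_inv_def by blast
  from m(1) assms(2) have lo: "lo = N" "N \<le> m * wd" by auto
  with m show "mset (slice b 0 N) = mset (slice a 0 N)" by simp
  show "runs_sorted f wd N b"
    unfolding runs_sorted_def
  proof
    fix m'
    show "sorted (map f (slice b (m' * wd) (min (Suc m' * wd) N)))"
    proof (cases "m' < m")
      case False
      then have "m * wd \<le> m' * wd" by simp
      with lo have "N \<le> m' * wd" by linarith
      then have empty: "[m' * wd..<min (Suc m' * wd) N] = []" by simp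
      show ?thesis unfolding empty by simp
    qed (rule m)
  qed
qed

text \<open>A border \<open>lo = m * (wd + wd)\<close> of the wide blocks makes the two halves the
  narrow blocks number \<open>2 * m\<close> and \<open>Suc (2 * m)\<close>. If the array ends inside
  the first half, the second is empty.\<close>

lemma runs_sorted_halves:
  assumes runs: "runs_sorted f wd N a" and "pass_inv g a' b (wd + wd) N lo" "lo < N"
    and mid: "mid = min (lo + wd) N" and hi: "hi = min (lo + (wd + wd)) N"
  shows "sorted (map f (slice a lo mid))" "sorted (map f (slice a mid hi))"
proof -
  obtain m where "lo = min (m * (wd + wd)) N"
    using assms unfolding pass_inv_def by blast
  with \<open>lo < N\<close> have m: "lo = m * (wd + wd)" by simp
  have eqs: "(2 * m) * wd = lo" "Suc (2 * m) * wd = lo + wd" "Suc (Suc (2 * m)) * wd = lo + (wd + wd)"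
    unfolding m by (simp_all add: algebra_simps)
  from runs have run: "sorted (map f (slice a (m * wd) (min (Suc m * wd) N)))" for m
    unfolding runs_sorted_def by blast
  show "sorted (map f (slice a lo mid))"
    using run[of "2 * m"] unfolding eqs mid .
  show "sorted (map f (slice a mid hi))"
  proof (cases "lo + wd \<le> N")
    case True
    then have mid': "mid = lo + wd" unfolding mid by simp
    show ?thesis using run[of "Suc (2 * m)"] unfolding eqs mid' hi .
  next
    case False
    then have empty: "[mid..<hi] = []" unfolding mid hi by simp
    show ?thesis unfolding empty by simp
  qed
qed

lemma runs_sorted_1: "runs_sorted f (Suc 0) N a"
  unfolding runs_sorted_def
proof
  fix m
  have "[m * Suc 0..<min (Suc m * Suc 0) N] = (if m < N then [m] else [])" by (simp add: min_def)
  then show "sorted (map f (slice a (m * Suc 0) (min (Suc m * Suc 0) N)))" by simp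
qed

lemma runs_sorted_final:
  assumes "runs_sorted f wd N a" "\<not> wd < N" shows "sorted (map f (slice a 0 N))"
proof -
  have "sorted (map f (slice a (0 * wd) (min (Suc 0 * wd) N)))"
    using assms(1) unfolding runs_sorted_def by blast
  moreover have "min (Suc 0 * wd) N = N" using assms(2) by simp
  ultimately show ?thesis by simp
qed

section \<open>The sorting program and its running time\<close>

abbreviation incr :: "vname \<Rightarrow> com" where
  "incr x \<equiv> NAssign x (NAdd (NVar x) (NConst 1))"

definition merge_com :: com where
  "merge_com = While (NLess (NVar ''k'') (NVar ''hi''))
    (Seq (Cond (BAnd (NLess (NVar ''i'') (NVar ''mid''))
          (BNot (BAnd (NLess (NVar ''j'') (NVar ''hi''))
             (RLess (RArr ''key'' (NArr ''a'' (NVar ''j''))) (RArr ''key'' (NArr ''a'' (NVar ''i'')))))))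
        (Seq (NStore ''b'' (NVar ''k'') (NArr ''a'' (NVar ''i''))) (incr ''i''))
        (Seq (NStore ''b'' (NVar ''k'') (NArr ''a'' (NVar ''j''))) (incr ''j'')))
      (incr ''k''))"

definition block_com :: com where
  "block_com =
    Seq (NAssign ''mid'' (NAdd (NVar ''lo'') (NVar ''wd'')))
    (Seq (Cond (NLess (NVar ''N'') (NVar ''mid'')) (NAssign ''mid'' (NVar ''N'')) Skip)
    (Seq (NAssign ''hi'' (NAdd (NVar ''lo'') (NAdd (NVar ''wd'') (NVar ''wd''))))
    (Seq (Cond (NLess (NVar ''N'') (NVar ''hi'')) (NAssign ''hi'' (NVar ''N'')) Skip)
    (Seq (NAssign ''i'' (NVar ''lo''))
    (Seq (NAssign ''j'' (NVar ''mid''))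
    (NAssign ''k'' (NVar ''lo'')))))))"

definition pass_com :: com where
  "pass_com = While (NLess (NVar ''lo'') (NVar ''N''))
    (Seq block_com (Seq merge_com (NAssign ''lo'' (NVar ''hi''))))"

definition copy_com :: com where
  "copy_com = While (NLess (NVar ''k'') (NVar ''N''))
    (Seq (NStore ''a'' (NVar ''k'') (NArr ''b'' (NVar ''k''))) (incr ''k''))"

definition sort_com :: com where
  "sort_com = Seq (NAssign ''wd'' (NConst 1))
    (While (NLess (NVar ''wd'') (NVar ''N''))
      (Seq (NAssign ''lo'' (NConst 0))
      (Seq pass_com
      (Seq (NAssign ''k'' (NConst 0))
      (Seq copy_com
      (NAssign ''wd'' (NAdd (NVar ''wd'') (NVar ''wd''))))))))"

text \<open>The time is proportional to the length of the block, as the amortized count over a pass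
  requires. The clause on cells below \<open>lo\<close> protects the blocks merged earlier in the
  same pass.\<close>

lemma merge_com_run:
  fixes s0 :: state
  defines "f \<equiv> rarr s0 ''key''" and "a \<equiv> narr s0 ''a''" and "lo \<equiv> nvar s0 ''lo''"
    and "mid \<equiv> nvar s0 ''mid''" and "hi \<equiv> nvar s0 ''hi''"
  assumes "nvar s0 ''i'' = lo" "nvar s0 ''j'' = mid" "nvar s0 ''k'' = lo"
    and "lo \<le> mid" "mid \<le> hi" "sorted (map f (slice a lo mid))" "sorted (map f (slice a mid hi))"
  shows "run merge_com s0 (\<lambda>t s. t \<le> 50 * (hi - lo) + 50 \<and> rvar s = rvar s0 \<and> rarr s = rarr s0 \<and>
    agree_except {''i'', ''j'', ''k''} (nvar s) (nvar s0) \<and> agree_except {''b''} (narr s) (narr s0) \<and>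
    (\<forall>q<lo. narr s ''b'' q = narr s0 ''b'' q) \<and>
    mset (slice (narr s ''b'') lo hi) = mset (slice a lo hi) \<and>
    sorted (map f (slice (narr s ''b'') lo hi)))"
proof -
  define I where "I m s \<longleftrightarrow> m = hi - nvar s ''k'' \<and> rvar s = rvar s0 \<and> rarr s = rarr s0 \<and>
    agree_except {''i'', ''j'', ''k''} (nvar s) (nvar s0) \<and> agree_except {''b''} (narr s) (narr s0) \<and>
    (\<forall>q<lo. narr s ''b'' q = narr s0 ''b'' q) \<and> lo \<le> nvar s ''k'' \<and>
    merge_inv f a (narr s ''b'') lo mid hi (nvar s ''i'') (nvar s ''j'') (nvar s ''k'')"
    for m and s :: state
  let ?b = "NLess (NVar ''k'') (NVar ''hi'')"
  have "run merge_com s0 (\<lambda>t s. (\<exists>m. I m s) \<and> \<not> bval ?b s \<and>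
      t \<le> (hi - lo) * (40 + 1 + bcost ?b) + 1 + bcost ?b)"
    unfolding merge_com_def
  proof (rule run_While_count, goal_cases)
    case 1
    show ?case using assms merge_inv_init[of lo mid hi f a] by (simp add: I_def)
  next
    case (2 m s)
    note I = 2(1)
    have ag: "agree_except {''i'', ''j'', ''k''} (nvar s) (nvar s0)" "agree_except {''b''} (narr s) (narr s0)"
      using I by (simp_all add: I_def)
    have v: "nvar s ''mid'' = mid" "nvar s ''hi'' = hi" "narr s ''a'' = a" "rarr s = rarr s0" "rarr s0 ''key'' = f"
      using I agree_exceptD[OF ag(1), of "''mid''"] agree_exceptD[OF ag(1), of "''hi''"] agree_exceptD[OF ag(2), of "''a''"]
      by (simp_all add: I_def mid_def hi_def a_def f_def)
    let ?i = "nvar s ''i''" and ?j = "nvar s ''j''" and ?k = "nvar s ''k''" and ?b = "narr s ''b''"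
    have inv: "merge_inv f a ?b lo mid hi ?i ?j ?k" and k: "?k < hi" and m: "m = hi - ?k" and lo: "lo \<le> ?k"
      and same: "rvar s = rvar s0" "\<forall>q<lo. ?b q = narr s0 ''b'' q"
      using I 2(2) v by (simp_all add: I_def)
    show ?case
    proof (cases "?i < mid \<and> \<not> (?j < hi \<and> f (a ?j) < f (a ?i))")
      case True
      then have "merge_inv f a (?b(?k := a ?i)) lo mid hi (Suc ?i) ?j (Suc ?k)"
        using merge_inv_left[OF inv] by auto
      then show ?thesis
        using True k m lo same ag by (simp add: I_def v)
    next
      case False
      \<comment> \<open>If the left run is used up, then \<open>i = mid\<close>, so the counting
        equation gives \<open>j = k < hi\<close>; otherwise the failed test itself contains
        \<open>j < hi\<close>.\<close>
      then have "?j < hi" using inv k unfolding merge_inv_def by linarith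
      with False have "merge_inv f a (?b(?k := a ?j)) lo mid hi ?i (Suc ?j) (Suc ?k)"
        using merge_inv_right[OF inv] by auto
      with False k m lo same ag show ?thesis
        by (cases "?i < mid") (simp_all add: I_def v)
    qed
  qed
  then show ?thesis
  proof (rule run_mono, goal_cases)
    case (1 t s)
    then obtain m where I: "I m s" by blast
    then have "agree_except {''i'', ''j'', ''k''} (nvar s) (nvar s0)" by (simp add: I_def)
    from agree_exceptD[OF this, of "''hi''"] 1 have k: "\<not> nvar s ''k'' < hi" by (simp add: hi_def)
    from I have inv: "merge_inv f a (narr s ''b'') lo mid hi (nvar s ''i'') (nvar s ''j'') (nvar s ''k'')"
      by (simp add: I_def)
    note merge_inv_final[OF inv k]
    moreover from 1 have "t \<le> 50 * (hi - lo) + 50" by simp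
    ultimately show ?case using I unfolding I_def by simp
  qed
qed

lemma block_com_run:
  "run block_com s0 (\<lambda>t s. t \<le> 60 \<and> rvar s = rvar s0 \<and> rarr s = rarr s0 \<and> narr s = narr s0 \<and>
    agree_except {''i'', ''j'', ''k'', ''mid'', ''hi''} (nvar s) (nvar s0) \<and>
    nvar s ''mid'' = min (nvar s0 ''lo'' + nvar s0 ''wd'') (nvar s0 ''N'') \<and>
    nvar s ''hi'' = min (nvar s0 ''lo'' + (nvar s0 ''wd'' + nvar s0 ''wd'')) (nvar s0 ''N'') \<and>
    nvar s ''i'' = nvar s0 ''lo'' \<and> nvar s ''j'' = nvar s ''mid'' \<and> nvar s ''k'' = nvar s0 ''lo'')"
  by (simp add: block_com_def)

text \<open>The potential is \<open>200 * (N - lo)\<close>: each block pays in proportion to its own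
  length, so a pass is linear in \<open>N\<close> however many blocks it has.\<close>

lemma pass_com_run:
  fixes s0 :: state
  defines "f \<equiv> rarr s0 ''key''" and "a \<equiv> narr s0 ''a''" and "N \<equiv> nvar s0 ''N''" and "wd \<equiv> nvar s0 ''wd''"
  assumes lo: "nvar s0 ''lo'' = 0" and wd: "0 < wd" and runs: "runs_sorted f wd N a"
  shows "run pass_com s0 (\<lambda>t s. t \<le> 200 * N + 10 \<and> rvar s = rvar s0 \<and> rarr s = rarr s0 \<and>
    agree_except {''i'', ''j'', ''k'', ''lo'', ''mid'', ''hi''} (nvar s) (nvar s0) \<and>
    agree_except {''b''} (narr s) (narr s0) \<and>
    runs_sorted f (wd + wd) N (narr s ''b'') \<and> mset (slice (narr s ''b'') 0 N) = mset (slice a 0 N))"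
proof -
  let ?X = "{''i'', ''j'', ''k'', ''lo'', ''mid'', ''hi''}"
  define I where "I c s \<longleftrightarrow> c = 200 * (N - nvar s ''lo'') \<and> rvar s = rvar s0 \<and> rarr s = rarr s0 \<and>
    agree_except ?X (nvar s) (nvar s0) \<and> agree_except {''b''} (narr s) (narr s0) \<and>
    pass_inv f a (narr s ''b'') (wd + wd) N (nvar s ''lo'')"
    for c and s :: state
  let ?b = "NLess (NVar ''lo'') (NVar ''N'')"
  have "run pass_com s0 (\<lambda>t s. (\<exists>c. I c s) \<and> \<not> bval ?b s \<and> t \<le> 200 * N + 1 + bcost ?b)"
    unfolding pass_com_def
  proof (rule run_While, goal_cases)
    case 1
    show ?case by (simp add: I_def lo pass_inv_init)
  next
    case (2 c s)
    then have c: "c = 200 * (N - nvar s ''lo'')" and same: "rvar s = rvar s0" "rarr s = rarr s0"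
      and ag: "agree_except ?X (nvar s) (nvar s0)" "agree_except {''b''} (narr s) (narr s0)"
      and inv: "pass_inv f a (narr s ''b'') (wd + wd) N (nvar s ''lo'')"
      by (simp_all add: I_def)
    have v: "nvar s ''N'' = N" "nvar s ''wd'' = wd" "narr s ''a'' = a" "rarr s ''key'' = f"
      using agree_exceptD[OF ag(1), of "''N''"] agree_exceptD[OF ag(1), of "''wd''"] agree_exceptD[OF ag(2), of "''a''"] same
      by (simp_all add: N_def wd_def a_def f_def)
    let ?lo = "nvar s ''lo''"
    from 2(2) v have less: "?lo < N" by simp
    define mid where "mid = min (?lo + wd) N"
    define hi where "hi = min (?lo + (wd + wd)) N"
    have le: "?lo \<le> mid" "mid \<le> hi" "?lo < hi" using less wd by (simp_all add: mid_def hi_def)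
    show ?case
    proof (rule run_SeqI[OF block_com_run], goal_cases)
      case (1 t1 s1)
      then have 1: "t1 \<le> 60" "rvar s1 = rvar s0" "rarr s1 = rarr s0" "narr s1 = narr s"
        and ag1: "agree_except {''i'', ''j'', ''k'', ''mid'', ''hi''} (nvar s1) (nvar s)"
        and mh: "nvar s1 ''mid'' = mid" "nvar s1 ''hi'' = hi"
        and ijk: "nvar s1 ''i'' = ?lo" "nvar s1 ''j'' = mid" "nvar s1 ''k'' = ?lo"
        using same v unfolding mid_def hi_def by simp_all
      have v1: "nvar s1 ''lo'' = ?lo" "narr s1 ''a'' = a" "rarr s1 ''key'' = f"
        using agree_exceptD[OF ag1, of "''lo''"] v 1 by (simp_all add: f_def)
      have agX: "agree_except ?X (nvar s1) (nvar s0)"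
        by (rule agree_except_trans[OF ag1 ag(1)]) auto
      have srt: "sorted (map f (slice a ?lo mid))" "sorted (map f (slice a mid hi))"
        by (rule runs_sorted_halves[OF runs inv less mid_def hi_def])+
      have "run merge_com s1 (\<lambda>t s. t \<le> 50 * (hi - ?lo) + 50 \<and> rvar s = rvar s1 \<and> rarr s = rarr s1 \<and>
          agree_except {''i'', ''j'', ''k''} (nvar s) (nvar s1) \<and> agree_except {''b''} (narr s) (narr s1) \<and>
          (\<forall>q<?lo. narr s ''b'' q = narr s1 ''b'' q) \<and>
          mset (slice (narr s ''b'') ?lo hi) = mset (slice a ?lo hi) \<and>
          sorted (map f (slice (narr s ''b'') ?lo hi)))"
        using merge_com_run[of s1] le srt unfolding v1 mh ijk by simp
      then show ?case
      proof (rule run_SeqI, goal_cases)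
        case (1 t2 s2)
        then have t2: "t2 \<le> 50 * (hi - ?lo) + 50" and 2: "rvar s2 = rvar s0" "rarr s2 = rarr s0"
          and ag2: "agree_except {''i'', ''j'', ''k''} (nvar s2) (nvar s1)" "agree_except {''b''} (narr s2) (narr s)"
          and b: "\<And>q. q < ?lo \<Longrightarrow> narr s2 ''b'' q = narr s ''b'' q"
          and new: "mset (slice (narr s2 ''b'') ?lo hi) = mset (slice a ?lo hi)"
            "sorted (map f (slice (narr s2 ''b'') ?lo hi))"
          using \<open>rvar s1 = rvar s0\<close> \<open>rarr s1 = rarr s0\<close> \<open>narr s1 = narr s\<close> by simp_all
        have hi2: "nvar s2 ''hi'' = hi" using agree_exceptD[OF ag2(1), of "''hi''"] mh by simp
        have agX2: "agree_except ?X (nvar s2) (nvar s0)"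
          by (rule agree_except_trans[OF ag2(1) agX]) auto
        have agb: "agree_except {''b''} (narr s2) (narr s0)"
          by (rule agree_except_trans[OF ag2(2) ag(2)]) auto
        have "pass_inv f a (narr s2 ''b'') (wd + wd) N hi"
          by (rule pass_inv_step[OF inv less hi_def b new])
        then have I: "I (200 * (N - hi)) (s2\<lparr>nvar := (nvar s2)(''lo'' := hi)\<rparr>)"
          using 2 agX2 agb by (simp add: I_def)
        have "hi \<le> N" by (simp add: hi_def)
        \<comment> \<open>A block is nonempty because \<open>wd\<close> is positive, so the surplus
          \<open>150 * (hi - ?lo)\<close> over the merging cost absorbs the constant overhead of the
          round.\<close>
        then have "N - ?lo = (N - hi) + (hi - ?lo)" "1 \<le> hi - ?lo" using le by linarith+
        then have "200 * (N - hi) + (1 + t1 + (1 + t2 + 2)) + 1 + 3 \<le> c"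
          using t2 \<open>t1 \<le> 60\<close> unfolding c by linarith
        with I show ?case by (auto simp: hi2)
      qed
    qed
  qed
  then show ?thesis
  proof (rule run_mono, goal_cases)
    case (1 t s)
    then obtain c where I: "I c s" by blast
    then have ag: "agree_except ?X (nvar s) (nvar s0)" "agree_except {''b''} (narr s) (narr s0)"
      and same: "rvar s = rvar s0" "rarr s = rarr s0"
      and inv: "pass_inv f a (narr s ''b'') (wd + wd) N (nvar s ''lo'')"
      by (simp_all add: I_def)
    from agree_exceptD[OF ag(1), of "''N''"] 1 have k: "\<not> nvar s ''lo'' < N" by (simp add: N_def)
    have "t \<le> 200 * N + 10" using 1 by simp
    with pass_inv_final[OF inv k] ag same show ?case by simp
  qed
qed

lemma copy_com_run:
  fixes s0 :: state
  assumes k: "nvar s0 ''k'' = 0"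
  shows "run copy_com s0 (\<lambda>t s. t \<le> 20 * nvar s0 ''N'' + 10 \<and> rvar s = rvar s0 \<and> rarr s = rarr s0 \<and>
    agree_except {''k''} (nvar s) (nvar s0) \<and> agree_except {''a''} (narr s) (narr s0) \<and>
    (\<forall>q<nvar s0 ''N''. narr s ''a'' q = narr s0 ''b'' q))"
proof -
  define N where "N = nvar s0 ''N''"
  define I where "I m s \<longleftrightarrow> m = N - nvar s ''k'' \<and> rvar s = rvar s0 \<and> rarr s = rarr s0 \<and>
    agree_except {''k''} (nvar s) (nvar s0) \<and> agree_except {''a''} (narr s) (narr s0) \<and>
    (\<forall>q<nvar s ''k''. narr s ''a'' q = narr s0 ''b'' q)"
    for m and s :: state
  let ?b = "NLess (NVar ''k'') (NVar ''N'')"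
  have "run copy_com s0 (\<lambda>t s. (\<exists>m. I m s) \<and> \<not> bval ?b s \<and> t \<le> N * (12 + 1 + bcost ?b) + 1 + bcost ?b)"
    unfolding copy_com_def
  proof (rule run_While_count, goal_cases)
    case 1
    show ?case by (simp add: I_def k)
  next
    case (2 m s)
    then have m: "m = N - nvar s ''k''" and same: "rvar s = rvar s0" "rarr s = rarr s0"
      and ag: "agree_except {''k''} (nvar s) (nvar s0)" "agree_except {''a''} (narr s) (narr s0)"
      and eq: "\<forall>q<nvar s ''k''. narr s ''a'' q = narr s0 ''b'' q"
      by (simp_all add: I_def)
    have v: "nvar s ''N'' = N" "narr s ''b'' = narr s0 ''b''"
      using agree_exceptD[OF ag(1), of "''N''"] agree_exceptD[OF ag(2), of "''b''"] by (simp_all add: N_def)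
    with 2 show ?case
      using m same ag eq by (simp add: I_def less_Suc_eq)
  qed
  then show ?thesis
  proof (rule run_mono, goal_cases)
    case (1 t s)
    then obtain m where I: "I m s" by blast
    then have ag: "agree_except {''k''} (nvar s) (nvar s0)" "agree_except {''a''} (narr s) (narr s0)"
      and same: "rvar s = rvar s0" "rarr s = rarr s0"
      and eq: "\<forall>q<nvar s ''k''. narr s ''a'' q = narr s0 ''b'' q"
      by (simp_all add: I_def)
    from agree_exceptD[OF ag(1), of "''N''"] 1 have "\<not> nvar s ''k'' < N" by (simp add: N_def)
    with eq have "\<forall>q<N. narr s ''a'' q = narr s0 ''b'' q" by simp
    moreover have "t \<le> 20 * N + 10" using 1 by simp
    ultimately show ?case using ag same unfolding N_def by simp
  qed
qed

lemma slice_cong: "(\<And>q. q < N \<Longrightarrow> a q = b q) \<Longrightarrow> j \<le> N \<Longrightarrow> slice a i j = slice b i j"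
  by (rule map_cong) simp_all

lemma runs_sorted_cong:
  assumes "\<And>q. q < N \<Longrightarrow> a q = b q"
  shows "runs_sorted f wd N a \<longleftrightarrow> runs_sorted f wd N b"
proof -
  have eq: "slice a i (min j N) = slice b i (min j N)" for i j
    by (rule slice_cong[of N]) (simp_all add: assms)
  show ?thesis unfolding runs_sorted_def eq by (rule refl)
qed

text \<open>After \<open>q\<close> passes the width is \<open>2 ^ q\<close>, so \<open>L\<close>
  passes reach \<open>N\<close>; the loop counter \<open>m\<close> is the number
  \<open>L - q\<close> of passes left.\<close>

lemma sort_com_run:
  fixes s0 :: state
  defines "f \<equiv> rarr s0 ''key''" and "N \<equiv> nvar s0 ''N''"
  assumes L: "N \<le> 2 ^ L"
  shows "run sort_com s0 (\<lambda>t s. t \<le> L * (220 * N + 50) + 20 \<and> rvar s = rvar s0 \<and> rarr s = rarr s0 \<and>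
    agree_except {''i'', ''j'', ''k'', ''lo'', ''mid'', ''hi'', ''wd''} (nvar s) (nvar s0) \<and>
    sorted (map f (slice (narr s ''a'') 0 N)) \<and>
    mset (slice (narr s ''a'') 0 N) = mset (slice (narr s0 ''a'') 0 N))"
proof -
  let ?X = "{''i'', ''j'', ''k'', ''lo'', ''mid'', ''hi'', ''wd''}"
  define I where "I m s \<longleftrightarrow> rvar s = rvar s0 \<and> rarr s = rarr s0 \<and> agree_except ?X (nvar s) (nvar s0) \<and>
    (\<exists>q. nvar s ''wd'' = 2 ^ q \<and> m + q = L) \<and> runs_sorted f (nvar s ''wd'') N (narr s ''a'') \<and>
    mset (slice (narr s ''a'') 0 N) = mset (slice (narr s0 ''a'') 0 N)"
    for m and s :: state
  let ?b = "NLess (NVar ''wd'') (NVar ''N'')"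
  have "run sort_com s0 (\<lambda>t s. (\<exists>m. I m s) \<and> \<not> bval ?b s \<and>
     t \<le> 1 + 2 + (L * (220 * N + 40 + 1 + bcost ?b) + 1 + bcost ?b))"
    unfolding sort_com_def
  proof (rule run_SeqI[where ?Q1.0 = "\<lambda>t s. t = 2 \<and> s = s0\<lparr>nvar := (nvar s0)(''wd'' := 1)\<rparr>"], goal_cases)
    case 1
    show ?case by simp
  next
    case (2 t1 s1)
    have "I L s1" using 2 runs_sorted_1[of f N] by (auto simp: I_def intro: exI[of _ 0])
    then have "run (While ?b (Seq (NAssign ''lo'' (NConst 0)) (Seq pass_com (Seq (NAssign ''k'' (NConst 0))
      (Seq copy_com (NAssign ''wd'' (NAdd (NVar ''wd'') (NVar ''wd''))))))))
      s1 (\<lambda>t s. (\<exists>m. I m s) \<and> \<not> bval ?b s \<and> t \<le> L * (220 * N + 40 + 1 + bcost ?b) + 1 + bcost ?b)"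
    proof (rule run_While_count, goal_cases)
      case (1 m s)
      then have same: "rvar s = rvar s0" "rarr s = rarr s0" and ag: "agree_except ?X (nvar s) (nvar s0)"
        and runs: "runs_sorted f (nvar s ''wd'') N (narr s ''a'')"
        and mset: "mset (slice (narr s ''a'') 0 N) = mset (slice (narr s0 ''a'') 0 N)"
        by (simp_all add: I_def)
      from 1 obtain q where q: "nvar s ''wd'' = 2 ^ q" "m + q = L" unfolding I_def by blast
      have N: "nvar s ''N'' = N" using agree_exceptD[OF ag, of "''N''"] by (simp add: N_def)
      \<comment> \<open>With no pass left the width would be \<open>2 ^ L\<close>, which is at least
        \<open>N\<close>, against the loop test.\<close>
      have "0 < m"
      proof (rule ccontr)
        assume "\<not> 0 < m"
        with q 1(2) N L show False by simp
      qed
      define s' where "s' = s\<lparr>nvar := (nvar s)(''lo'' := 0)\<rparr>"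
      have agX: "agree_except ?X (nvar s') (nvar s0)" using ag by (simp add: s'_def)
      have "run pass_com s' (\<lambda>t s. t \<le> 200 * N + 10 \<and> rvar s = rvar s0 \<and> rarr s = rarr s0 \<and>
        agree_except {''i'', ''j'', ''k'', ''lo'', ''mid'', ''hi''} (nvar s) (nvar s') \<and>
        agree_except {''b''} (narr s) (narr s') \<and>
        runs_sorted f (2 ^ q + 2 ^ q) N (narr s ''b'') \<and>
        mset (slice (narr s ''b'') 0 N) = mset (slice (narr s0 ''a'') 0 N))"
        using pass_com_run[of s'] runs mset same q N by (simp add: s'_def f_def)
      then have "run (Seq pass_com (Seq (NAssign ''k'' (NConst 0))
          (Seq copy_com (NAssign ''wd'' (NAdd (NVar ''wd'') (NVar ''wd'')))))) s'
          (\<lambda>t s. t \<le> 220 * N + 36 \<and> I (m - 1) s)"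
      proof (rule run_SeqI, goal_cases)
        case (1 t2 s2)
        then have t2: "t2 \<le> 200 * N + 10" and 2: "rvar s2 = rvar s0" "rarr s2 = rarr s0"
          and ag2: "agree_except {''i'', ''j'', ''k'', ''lo'', ''mid'', ''hi''} (nvar s2) (nvar s')"
          and b: "runs_sorted f (2 ^ q + 2 ^ q) N (narr s2 ''b'')"
            "mset (slice (narr s2 ''b'') 0 N) = mset (slice (narr s0 ''a'') 0 N)"
          by simp_all
        have v2: "nvar s2 ''N'' = N" "nvar s2 ''wd'' = 2 ^ q"
          using agree_exceptD[OF ag2, of "''N''"] agree_exceptD[OF ag2, of "''wd''"] N q by (simp_all add: s'_def)
        have agX2: "agree_except ?X (nvar s2) (nvar s0)"
          by (rule agree_except_trans[OF ag2 agX]) auto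
        define s3 where "s3 = s2\<lparr>nvar := (nvar s2)(''k'' := 0)\<rparr>"
        have "run copy_com s3 (\<lambda>t s. t \<le> 20 * N + 10 \<and> rvar s = rvar s0 \<and> rarr s = rarr s0 \<and>
          agree_except {''k''} (nvar s) (nvar s3) \<and> agree_except {''a''} (narr s) (narr s3) \<and>
          (\<forall>q<N. narr s ''a'' q = narr s2 ''b'' q))"
          using copy_com_run[of s3] 2 v2 by (simp add: s3_def)
        then have "run (Seq copy_com (NAssign ''wd'' (NAdd (NVar ''wd'') (NVar ''wd'')))) s3
           (\<lambda>t s. t \<le> 20 * N + 20 \<and> I (m - 1) s)"
        proof (rule run_SeqI, goal_cases)
          case (1 t4 s4)
          then have t4: "t4 \<le> 20 * N + 10" and 4: "rvar s4 = rvar s0" "rarr s4 = rarr s0"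
            and ag4: "agree_except {''k''} (nvar s4) (nvar s3)"
            and a: "\<And>q. q < N \<Longrightarrow> narr s4 ''a'' q = narr s2 ''b'' q"
            by simp_all
          have v4: "nvar s4 ''wd'' = 2 ^ q"
            using agree_exceptD[OF ag4, of "''wd''"] v2 by (simp add: s3_def)
          have ag3: "agree_except ?X (nvar s3) (nvar s0)" using agX2 by (simp add: s3_def)
          have agX4: "agree_except ?X (nvar s4) (nvar s0)"
            by (rule agree_except_trans[OF ag4 ag3]) auto
          have "runs_sorted f (2 ^ q + 2 ^ q) N (narr s4 ''a'')"
            using b(1) runs_sorted_cong[of N "narr s4 ''a''" "narr s2 ''b''"] a by simp
          moreover have "slice (narr s4 ''a'') 0 N = slice (narr s2 ''b'') 0 N"
            by (rule slice_cong[of N]) (simp_all add: a)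
          with b(2) have "mset (slice (narr s4 ''a'') 0 N) = mset (slice (narr s0 ''a'') 0 N)"
            by (simp only:)
          moreover have "\<exists>q'. 2 ^ q + 2 ^ q = (2::nat) ^ q' \<and> m - 1 + q' = L"
            using q(2) \<open>0 < m\<close> by (intro exI[of _ "Suc q"]) simp
          ultimately show ?case
            using 4 agX4 t4 by (simp add: I_def v4)
        qed
        then show ?case
          using t2 by (auto simp: s3_def elim!: run_mono)
      qed
      then show ?case
        using \<open>0 < m\<close> by (auto simp: s'_def elim!: run_mono)
    qed
    then show ?case
      by (rule run_mono) (use 2 in simp)
  qed
  then show ?thesis
  proof (rule run_mono, goal_cases)
    case (1 t s)
    then obtain m where I: "I m s" by blast
    then have ag: "agree_except ?X (nvar s) (nvar s0)" and same: "rvar s = rvar s0" "rarr s = rarr s0"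
      and runs: "runs_sorted f (nvar s ''wd'') N (narr s ''a'')"
      and mset: "mset (slice (narr s ''a'') 0 N) = mset (slice (narr s0 ''a'') 0 N)"
      by (simp_all add: I_def)
    from agree_exceptD[OF ag, of "''N''"] 1 have wd: "\<not> nvar s ''wd'' < N" by (simp add: N_def)
    have "L * (220 * N + 40 + 1 + bcost ?b) \<le> L * (220 * N + 50)" by (rule mult_left_mono) simp_all
    moreover have "bcost ?b = 3" by simp
    ultimately have "t \<le> L * (220 * N + 50) + 20" using 1 by linarith
    with runs_sorted_final[OF runs wd] mset ag same show ?case by simp
  qed
qed

section \<open>Regions between boundary lines\<close>

lemma sum_lessThan_add:
  fixes g :: "nat \<Rightarrow> 'a::comm_monoid_add"
  shows "sum g {..<n + m} = sum g {..<n} + (\<Sum>i<m. g (n + i))"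
  by (induction m) (simp_all add: ac_simps)

locale strip_instance =
  fixes n :: nat and y :: "nat \<Rightarrow> real" and w :: "nat \<Rightarrow> nat \<Rightarrow> real" and c1 c2 l r :: real
  assumes pos: "\<And>i. i < n \<Longrightarrow> 0 < w 2 i"
    and l_less_r: "l < r"
    and ex_solution: "\<exists>lam. is_solution n y w c1 c2 lam \<and> fst lam \<in> {l<..<r}"
    and no_intersection: "\<And>p. intersection_point n y w p \<Longrightarrow> fst p \<notin> {l<..<r}"
begin

text \<open>Event \<open>e < n\<close> is the boundary line of index \<open>e\<close> with right-hand side \<open>1\<close>, event \<open>n + i\<close> that of
  index \<open>i\<close> with right-hand side \<open>-1\<close>. As a graph over the first coordinate, line \<open>e\<close> is
  \<open>z = F e x = ic e - x * sl e\<close>.\<close>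

definition sgn_of :: "nat \<Rightarrow> real" where "sgn_of e = (if e < n then 1 else - 1)"
definition ix :: "nat \<Rightarrow> nat" where "ix e = (if e < n then e else e - n)"
definition ic :: "nat \<Rightarrow> real" where "ic e = (y (ix e) - sgn_of e) / w 2 (ix e)"
definition sl :: "nat \<Rightarrow> real" where "sl e = w 1 (ix e) / w 2 (ix e)"
definition wt :: "nat \<Rightarrow> real" where "wt e = sgn_of e * (w 2 (ix e))\<^sup>2"
definition F :: "nat \<Rightarrow> real \<Rightarrow> real" where "F e x = ic e - x * sl e"
definition mid :: real where "mid = (l + r) / 2"

text \<open>In component \<open>j\<close> of \<open>h\<close>, event \<open>e\<close> has the
  coefficient \<open>wt e * (w j (ix e) / w 2 (ix e))\<close>, which is \<open>wt e * sl e\<close>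
  for \<open>j = 1\<close> and \<open>wt e\<close> for \<open>j = 2\<close>. Expanding
  \<open>F e x - z\<close> over the lines \<open>P\<close> below a region gives the matrix with rows
  \<open>mA, mB\<close> and \<open>mB, mC\<close> and the right-hand sides
  \<open>d1, d2\<close>.\<close>

definition mA :: "nat set \<Rightarrow> real" where "mA P = (\<Sum>e\<in>P. wt e * sl e * sl e)"
definition mB :: "nat set \<Rightarrow> real" where "mB P = (\<Sum>e\<in>P. wt e * sl e)"
definition mC :: "nat set \<Rightarrow> real" where "mC P = (\<Sum>e\<in>P. wt e)"
definition d1 :: "nat set \<Rightarrow> real" where "d1 P = (\<Sum>e\<in>P. wt e * sl e * ic e) + (\<Sum>i<n. w 1 i) - c1"
definition d2 :: "nat set \<Rightarrow> real" where "d2 P = (\<Sum>e\<in>P. wt e * ic e) + (\<Sum>i<n. w 2 i) - c2"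

section \<open>Hinge form of \<open>h\<close> and the linear system belonging to a set of
  lines\<close>

lemma ix_less: "e < n + n \<Longrightarrow> ix e < n"
  by (auto simp: ix_def)

lemma mid_in: "l < mid" "mid < r"
  using l_less_r by (simp_all add: mid_def)

text \<open>The clamp of \<open>u\<close> to \<open>[-1, 1]\<close> is \<open>1 + min 0 (u - 1) - min 0 (u + 1)\<close>. Hence each event contributes
  one hinge to \<open>h\<close>, which is active exactly on the side above its line.\<close>

lemma h_comp_eq:
  assumes i: "i < n"
  shows "h_comp y w j i (x, z) =
    w j i + w j i * w 2 i * (min 0 (F i x - z) - min 0 (F (n + i) x - z))"
proof -
  define u where "u = y i - x * w 1 i - z * w 2 i"
  have "h_comp y w j i (x, z) = w j i * (1 + min 0 (u - 1) - min 0 (u + 1))"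
  proof -
    have "h_comp y w j i (x, z) = (if 1 < u then w j i else if u < - 1 then - w j i else w j i * u)"
      by (auto simp: h_comp_def lin_def u_def)
    then show ?thesis by (auto simp: min_def)
  qed
  moreover have "w j i * w 2 i * (min 0 p - min 0 q) = w j i * (min 0 (w 2 i * p) - min 0 (w 2 i * q))"
    for p q
  proof -
    have "min 0 (w 2 i * t) = w 2 i * min 0 t" for t
      using pos[OF i] by (auto simp: min_mult_distrib_left)
    then show ?thesis by (simp only: right_diff_distrib mult.assoc)
  qed
  moreover have "w 2 i * (F i x - z) = u - 1" "w 2 i * (F (n + i) x - z) = u + 1"
    using pos[OF i] i by (simp_all add: F_def ic_def sl_def sgn_of_def ix_def u_def field_simps)
  ultimately show ?thesis
    by (simp add: distrib_left right_diff_distrib)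
qed

text \<open>A hinge \<open>min 0 (F e x - z)\<close> is linear for the lines of \<open>P\<close> and
  zero for the others. It vanishes on its own line, so a point there may be counted on either side;
  this is why weak inequalities suffice and regions can be closed.\<close>

lemma h_affine:
  assumes P: "P \<subseteq> {..<n + n}" and below: "\<And>e. e \<in> P \<Longrightarrow> F e x \<le> z"
    and above: "\<And>e. e < n + n \<Longrightarrow> e \<notin> P \<Longrightarrow> z \<le> F e x"
  shows "h n y w j (x, z) =
    (\<Sum>i<n. w j i) + (\<Sum>e\<in>P. wt e * (w j (ix e) / w 2 (ix e)) * (F e x - z))"
proof -
  let ?g = "\<lambda>e. wt e * (w j (ix e) / w 2 (ix e)) * min 0 (F e x - z)"
  have "h n y w j (x, z) = (\<Sum>i<n. w j i) + (\<Sum>i<n. ?g i + ?g (n + i))"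
    unfolding h_def sum.distrib[symmetric]
  proof (rule sum.cong[OF refl])
    fix i assume "i \<in> {..<n}"
    then have i: "i < n" by simp
    then show "h_comp y w j i (x, z) = w j i + (?g i + ?g (n + i))"
      using pos[OF i] unfolding h_comp_eq[OF i]
      by (simp add: wt_def sgn_of_def ix_def power2_eq_square algebra_simps)
  qed
  also have "(\<Sum>i<n. ?g i + ?g (n + i)) = sum ?g {..<n + n}"
    by (simp add: sum_lessThan_add sum.distrib)
  also have "\<dots> = sum ?g P"
    using P above by (intro sum.mono_neutral_right) (auto simp: min_def)
  also have "\<dots> = (\<Sum>e\<in>P. wt e * (w j (ix e) / w 2 (ix e)) * (F e x - z))"
    by (intro sum.cong refl) (simp add: below min_absorb2)
  finally show ?thesis .
qed

lemma is_solution_affine: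
  assumes P: "P \<subseteq> {..<n + n}" and "\<And>e. e \<in> P \<Longrightarrow> F e x \<le> z"
    and "\<And>e. e < n + n \<Longrightarrow> e \<notin> P \<Longrightarrow> z \<le> F e x"
  shows "is_solution n y w c1 c2 (x, z) \<longleftrightarrow>
    mA P * x + mB P * z = d1 P \<and> mB P * x + mC P * z = d2 P"
proof -
  have "h n y w 1 (x, z) = (\<Sum>i<n. w 1 i) + (\<Sum>e\<in>P. wt e * sl e * (F e x - z))"
    using h_affine[OF assms, of 1] unfolding sl_def .
  moreover have "(\<Sum>e\<in>P. wt e * sl e * (F e x - z)) = (\<Sum>e\<in>P. wt e * sl e * ic e) - mA P * x - mB P * z"
    unfolding F_def mA_def mB_def sum_distrib_right sum_subtractf[symmetric]
    by (intro sum.cong) (simp_all add: algebra_simps)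
  moreover have "h n y w 2 (x, z) = (\<Sum>i<n. w 2 i) + (\<Sum>e\<in>P. wt e * (F e x - z))"
  proof -
    have one: "w 2 (ix e) / w 2 (ix e) = 1" if "e \<in> P" for e
      using P that pos[OF ix_less[of e]] by auto
    have "h n y w 2 (x, z) = (\<Sum>i<n. w 2 i) + (\<Sum>e\<in>P. wt e * (w 2 (ix e) / w 2 (ix e)) * (F e x - z))"
      by (rule h_affine[OF assms])
    also have "(\<Sum>e\<in>P. wt e * (w 2 (ix e) / w 2 (ix e)) * (F e x - z)) = (\<Sum>e\<in>P. wt e * (F e x - z))"
      by (rule sum.cong[OF refl]) (simp only: one mult_1_right)
    finally show ?thesis .
  qed
  moreover have "(\<Sum>e\<in>P. wt e * (F e x - z)) = (\<Sum>e\<in>P. wt e * ic e) - mB P * x - mC P * z"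
    unfolding F_def mB_def mC_def sum_distrib_right sum_subtractf[symmetric]
    by (intro sum.cong) (simp_all add: algebra_simps)
  ultimately show ?thesis
    unfolding is_solution_def d1_def d2_def by auto
qed

text \<open>The two lines of an index have opposite weights and equal slopes, so they cancel in
  every moment when both lie in \<open>P\<close>. By \<open>closed\<close> the remaining
  contributions to \<open>mC P\<close> are nonnegative; if they sum to zero, each is zero, and the
  other moments vanish with them.\<close>

lemma singular_moments:
  assumes P: "P \<subseteq> {..<n + n}" and closed: "\<And>i. i < n \<Longrightarrow> n + i \<in> P \<Longrightarrow> i \<in> P" and "mC P = 0"
  shows "mB P = 0" "mA P = 0"
proof -
  \<comment> \<open>This is 1 if only the lower line of index \<open>i\<close> is in
    \<open>P\<close>, and 0 if both or neither are; \<open>closed\<close> excludes the value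
    -1.\<close>
  let ?k = "\<lambda>i. (if i \<in> P then 1 else 0) - (if n + i \<in> P then 1 else 0) :: real"
  have split: "(\<Sum>e\<in>P. wt e * g (ix e)) = (\<Sum>i<n. (w 2 i)\<^sup>2 * ?k i * g i)" for g
  proof -
    have "(\<Sum>e\<in>P. wt e * g (ix e)) = (\<Sum>e<n + n. if e \<in> P then wt e * g (ix e) else 0)"
      using P by (simp add: sum.inter_restrict[symmetric] Int_absorb1)
    also have "\<dots> = (\<Sum>i<n. (w 2 i)\<^sup>2 * ?k i * g i)"
      unfolding sum_lessThan_add sum.distrib[symmetric]
      by (intro sum.cong) (auto simp: wt_def sgn_of_def ix_def)
    finally show ?thesis .
  qed
  have "0 \<le> ?k i" if "i < n" for i using closed[OF that] by auto
  moreover have "(\<Sum>i<n. (w 2 i)\<^sup>2 * ?k i) = 0"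
    using split[of "\<lambda>_. 1"] \<open>mC P = 0\<close> by (simp add: mC_def)
  ultimately have zero: "(w 2 i)\<^sup>2 * ?k i = 0" if "i < n" for i
    using that by (subst (asm) sum_nonneg_eq_0_iff) auto
  have "(\<Sum>e\<in>P. wt e * g (ix e)) = 0" for g
    unfolding split by (intro sum.neutral) (use zero in auto)
  from this[of "\<lambda>i. w 1 i / w 2 i"] this[of "\<lambda>i. (w 1 i / w 2 i) * (w 1 i / w 2 i)"]
  show "mB P = 0" "mA P = 0"
    by (simp_all add: mA_def mB_def sl_def mult.assoc)
qed

section \<open>The order of the boundary lines over the strip\<close>

definition line :: "nat \<Rightarrow> (real \<times> real) set" where
  "line e = {lam. y (ix e) - fst lam * w 1 (ix e) - snd lam * w 2 (ix e) = sgn_of e}"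

lemma line_boundary: "e < n + n \<Longrightarrow> line e \<in> boundary_lines n y w"
  unfolding line_def boundary_lines_def using ix_less[of e]
  by (auto simp: sgn_of_def intro!: exI[of _ "ix e"] exI[of _ "sgn_of e"])

lemma mem_line: "e < n + n \<Longrightarrow> (x, z) \<in> line e \<longleftrightarrow> z = F e x"
proof -
  assume "e < n + n"
  then have nz: "w 2 (ix e) \<noteq> 0" using pos[OF ix_less[of e]] by simp
  have F: "F e x = (y (ix e) - sgn_of e - x * w 1 (ix e)) / w 2 (ix e)"
    by (simp add: F_def ic_def sl_def diff_divide_distrib)
  have "z = F e x \<longleftrightarrow> z * w 2 (ix e) = y (ix e) - sgn_of e - x * w 1 (ix e)"
    unfolding F by (rule nonzero_eq_divide_eq[OF nz])
  then show ?thesis by (auto simp: line_def)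
qed

text \<open>An intersection point needs two lines that differ as point sets. A common point inside
  the strip therefore forces equal sets, and equal sets are equal graphs since \<open>w 2\<close> is
  positive.\<close>

lemma lines_meet:
  assumes e: "e < n + n" "e' < n + n" and x: "x \<in> {l<..<r}" and eq: "F e x = F e' x"
  shows "F e = F e'"
proof -
  have "(x, F e x) \<in> line e" "(x, F e x) \<in> line e'" using e eq by (simp_all add: mem_line)
  then have "line e = line e'"
    using no_intersection[of "(x, F e x)"] x e line_boundary unfolding intersection_point_def by auto
  then show ?thesis
    using mem_line[OF e(1)] mem_line[OF e(2)] by (intro ext) metis
qed

text \<open>A change of order would be a zero of an affine function, hence an intersection point strictly
  inside the strip, because \<open>mid\<close> is an interior point.\<close>

lemma F_order:
  assumes e: "e < n + n" "e' < n + n" and le: "F e mid \<le> F e' mid" and x: "l \<le> x" "x \<le> r"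
  shows "F e x \<le> F e' x"
proof (rule ccontr)
  assume gt: "\<not> F e x \<le> F e' x"
  define g where "g t = F e t - F e' t" for t
  have g: "g t = g mid + (t - mid) * (sl e' - sl e)" for t
    by (simp add: g_def F_def algebra_simps)
  have "g mid \<le> 0" "0 < g x" using le gt by (simp_all add: g_def)
  \<comment> \<open>The zero of \<open>g\<close> on the segment from \<open>mid\<close>
    (\<open>q = 0\<close>) to \<open>x\<close> (\<open>q = 1\<close>). As \<open>g x\<close> is
    positive, \<open>q < 1\<close>, so the crossing lies strictly inside the strip even if
    \<open>x\<close> is \<open>l\<close> or \<open>r\<close>.\<close>
  define q where "q = - g mid / (g x - g mid)"
  have q: "0 \<le> q" "q < 1" using \<open>g mid \<le> 0\<close> \<open>0 < g x\<close> by (simp_all add: q_def field_simps)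
  define t where "t = mid + q * (x - mid)"
  have "g t = g mid + q * ((x - mid) * (sl e' - sl e))" by (subst g) (simp add: t_def)
  also have "(x - mid) * (sl e' - sl e) = g x - g mid" using g[of x] by simp
  also have "g mid + q * (g x - g mid) = 0" using \<open>g mid \<le> 0\<close> \<open>0 < g x\<close> by (simp add: q_def)
  finally have "F e t = F e' t" by (simp add: g_def)
  moreover have "t \<in> {l<..<r}"
  proof -
    have "t = (1 - q) * mid + q * x" by (simp add: t_def algebra_simps)
    moreover have "(1 - q) * l < (1 - q) * mid" "(1 - q) * mid < (1 - q) * r" using q mid_in by simp_all
    moreover have "q * l \<le> q * x" "q * x \<le> q * r" using q x by (simp_all add: mult_left_mono)
    moreover have "(1 - q) * l + q * l = l" "(1 - q) * r + q * r = r" by (simp_all add: algebra_simps)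
    ultimately show ?thesis by auto
  qed
  ultimately have "F e = F e'" using lines_meet e by blast
  with gt show False by simp
qed

section \<open>Regions between consecutive lines\<close>

definition event_order :: "(nat \<Rightarrow> nat) \<Rightarrow> bool" where
  "event_order a \<longleftrightarrow> bij_betw a {..<n + n} {..<n + n} \<and>
    (\<forall>p q. p \<le> q \<longrightarrow> q < n + n \<longrightarrow> F (a p) mid \<le> F (a q) mid)"

text \<open>Closed on all sides, although the given solution lies in the open strip: a candidate may
  end up at \<open>r\<close> or on a bounding line, and the affine formula still holds
  there.\<close>

definition region :: "(nat \<Rightarrow> nat) \<Rightarrow> nat \<Rightarrow> real \<Rightarrow> real \<Rightarrow> bool" where
  "region a k x z \<longleftrightarrow> l \<le> x \<and> x \<le> r \<and> F (a k) x \<le> z \<and> z \<le> F (a (Suc k)) x"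

context
  fixes a assumes order: "event_order a"
begin

lemma a_less: "q < n + n \<Longrightarrow> a q < n + n"
  using order unfolding event_order_def by (auto dest: bij_betw_apply)

lemma a_inj: "inj_on a {..<n + n}"
  using order unfolding event_order_def bij_betw_def by blast

lemma a_surj: "e < n + n \<Longrightarrow> \<exists>q<n + n. a q = e"
  using order unfolding event_order_def bij_betw_def by (metis imageE lessThan_iff)

lemma a_mono: "p \<le> q \<Longrightarrow> q < n + n \<Longrightarrow> l \<le> x \<Longrightarrow> x \<le> r \<Longrightarrow> F (a p) x \<le> F (a q) x"
  using order F_order[of "a p" "a q" x] a_less[of p] a_less[of q] unfolding event_order_def by auto

lemma processed_subset: "k \<le> n + n \<Longrightarrow> a ` {..<k} \<subseteq> {..<n + n}"
  using a_less by auto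

text \<open>This provides the hypothesis \<open>closed\<close> of \<open>singular_moments\<close>:
  since \<open>w 2 i\<close> is positive, the line with right-hand side 1 is strictly lower than its
  partner and comes earlier in the order.\<close>

lemma processed_closed:
  assumes k: "k \<le> n + n" and i: "i < n" and upper: "n + i \<in> a ` {..<k}"
  shows "i \<in> a ` {..<k}"
proof -
  obtain q where q: "q < k" "a q = n + i" using upper by auto
  obtain p where p: "p < n + n" "a p = i" using a_surj[of i] i by auto
  have "F i mid < F (n + i) mid"
    using pos[OF i] i by (simp add: F_def ic_def sl_def sgn_of_def ix_def divide_strict_right_mono)
  moreover have "F (a q) mid \<le> F (a p) mid" if "q \<le> p"
    using a_mono[OF that p(1)] mid_in by simp
  ultimately have "p < q" using p q by (cases "q \<le> p") auto
  with p q show ?thesis by force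
qed

text \<open>By \<open>a_mono\<close> the order is the same over every \<open>x\<close> of the closed
  strip, so the first \<open>Suc k\<close> events are below the whole region and all others above
  it.\<close>

lemma region_is_solution:
  assumes k: "Suc k < n + n" and reg: "region a k x z"
  defines "P \<equiv> a ` {..<Suc k}"
  shows "is_solution n y w c1 c2 (x, z) \<longleftrightarrow>
    mA P * x + mB P * z = d1 P \<and> mB P * x + mC P * z = d2 P"
proof (rule is_solution_affine)
  have x: "l \<le> x" "x \<le> r" and z: "F (a k) x \<le> z" "z \<le> F (a (Suc k)) x"
    using reg by (simp_all add: region_def)
  show "P \<subseteq> {..<n + n}" unfolding P_def using k by (intro processed_subset) simp
  show "F e x \<le> z" if "e \<in> P" for e
  proof -
    from that have "e \<in> a ` {..k}" unfolding P_def lessThan_Suc_atMost .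
    then obtain q where "q \<le> k" "a q = e" by auto
    with a_mono[of q k x] k x z show ?thesis by simp
  qed
  show "z \<le> F e x" if e: "e < n + n" "e \<notin> P" for e
  proof -
    obtain q where q: "q < n + n" "a q = e" using a_surj[OF e(1)] by auto
    have "Suc k \<le> q"
    proof (rule ccontr)
      assume "\<not> Suc k \<le> q"
      then have "q \<in> {..<Suc k}" by simp
      then have "a q \<in> P" unfolding P_def by (rule imageI)
      with q e show False by simp
    qed
    with a_mono[OF this q(1) x] q z show ?thesis by simp
  qed
qed

lemma ex_region_solution:
  assumes "0 < n"
  shows "\<exists>k x z. Suc k < n + n \<and> region a k x z \<and> is_solution n y w c1 c2 (x, z)"
proof -
  obtain x z where sol: "is_solution n y w c1 c2 (x, z)" and x: "l \<le> x" "x \<le> r"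
    using ex_solution by force
  let ?N = "n + n"
  have N: "Suc 0 < ?N" "0 < ?N" "?N - 1 < ?N" "Suc (?N - 2) = ?N - 1" using \<open>0 < n\<close> by simp_all
  have low: "F (a 0) x \<le> F e x" if "e < ?N" for e
    using a_surj[OF that] a_mono[of 0 _ x] x by auto
  have high: "F e x \<le> F (a (?N - 1)) x" if "e < ?N" for e
    using a_surj[OF that] a_mono[of _ "?N - 1" x] x N by auto
  consider "z < F (a 0) x" | "F (a (?N - 1)) x < z" | "F (a 0) x \<le> z" "z \<le> F (a (?N - 1)) x"
    by linarith
  then show ?thesis
  proof cases
    case 1
    have above: "z \<le> F e x" if "e < ?N" for e using low[OF that] 1 by simp
    \<comment> \<open>For both points the set of lines below can be taken empty. All moments are
      then zero and the system no longer mentions the point, so the solution may be lifted onto the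
      lowest line.\<close>
    have "is_solution n y w c1 c2 (x, F (a 0) x)"
      using sol is_solution_affine[of "{}" x z] is_solution_affine[of "{}" x "F (a 0) x"] low above
      by (simp add: mA_def mB_def mC_def)
    moreover have "region a 0 x (F (a 0) x)"
      using x a_mono[of 0 "Suc 0" x] N by (simp add: region_def)
    ultimately show ?thesis using N by blast
  next
    case 2
    let ?z = "F (a (?N - 1)) x"
    let ?Q = "{..<?N}"
    \<comment> \<open>Above all lines, events \<open>i\<close> and \<open>n + i\<close> cancel. The
      system is again free of the point, and the solution drops onto the highest line.\<close>
    have "(\<Sum>e<?N. wt e * g (ix e)) = 0" for g
      unfolding sum_lessThan_add sum.distrib[symmetric]
      by (intro sum.neutral) (auto simp: wt_def sgn_of_def ix_def)
    from this[of "\<lambda>i. w 1 i / w 2 i"] this[of "\<lambda>i. (w 1 i / w 2 i) * (w 1 i / w 2 i)"] this[of "\<lambda>_. 1"]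
    have "mA ?Q = 0" "mB ?Q = 0" "mC ?Q = 0"
      by (simp_all add: mA_def mB_def mC_def sl_def mult.assoc)
    moreover have "F e x \<le> z" if "e < ?N" for e using high[OF that] 2 by simp
    ultimately have "is_solution n y w c1 c2 (x, ?z)"
      using sol is_solution_affine[of ?Q x z] is_solution_affine[of ?Q x ?z] high by simp
    moreover have "region a (?N - 2) x ?z"
      unfolding region_def N(4) using x a_mono[of "?N - 2" "?N - 1" x] N by simp
    ultimately show ?thesis using N by (intro exI[of _ "?N - 2"]) auto
  next
    case 3
    define m where "m = (LEAST m. z \<le> F (a m) x)"
    have m: "z \<le> F (a m) x" unfolding m_def by (rule LeastI[of _ "?N - 1"]) (rule 3(2))
    have "m \<le> ?N - 1" unfolding m_def by (rule Least_le) (rule 3(2))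
    show ?thesis
    proof (cases m)
      case 0
      with m 3 have "z = F (a 0) x" by simp
      then have "region a 0 x z"
        using x a_mono[of 0 "Suc 0" x] N by (simp add: region_def)
      with sol N show ?thesis by blast
    next
      case (Suc k)
      then have "\<not> z \<le> F (a k) x" unfolding m_def using not_less_Least[of k] by (metis lessI)
      with m Suc x have "region a k x z" by (simp add: region_def)
      moreover have "Suc k < ?N" using Suc \<open>m \<le> ?N - 1\<close> N by linarith
      ultimately show ?thesis using sol by blast
    qed
  qed
qed

end

end

section \<open>Solving one region\<close>

text \<open>The largest point up to \<open>x\<close> at which \<open>al + be * t\<close> is
  nonnegative, provided there is one: for \<open>be \<ge> 0\<close> it is \<open>x\<close> itself,
  otherwise the root may cut it off.\<close>

definition clip :: "real \<Rightarrow> real \<Rightarrow> real \<Rightarrow> real" where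
  "clip al be x = (if be < 0 \<and> - al / be < x then - al / be else x)"

lemma clip_props:
  assumes "0 \<le> al + be * x0" "x0 \<le> x"
  shows "x0 \<le> clip al be x" "clip al be x \<le> x" "0 \<le> al + be * clip al be x"
proof -
  have root: "x0 \<le> - al / be" "al + be * (- al / be) = 0" if "be < 0"
    using assms that by (simp_all add: field_simps)
  show "x0 \<le> clip al be x" "clip al be x \<le> x" using root assms by (auto simp: clip_def)
  show "0 \<le> al + be * clip al be x"
  proof (cases "be < 0")
    case False
    then have "be * x0 \<le> be * x" using assms(2) by (simp add: mult_left_mono)
    with assms False show ?thesis by (simp add: clip_def)
  next
    case True
    show ?thesis
    proof (cases "- al / be < x")
      case True
      with root(2) \<open>be < 0\<close> show ?thesis by (simp add: clip_def)
    next
      case False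
      then have "be * (- al / be) \<le> be * x" using \<open>be < 0\<close> by (intro mult_left_mono_neg) simp_all
      with root(2) True False show ?thesis by (simp add: clip_def)
    qed
  qed
qed

lemma affine_nonneg_between:
  fixes al be :: real
  assumes "0 \<le> al + be * x0" "0 \<le> al + be * x1" "x0 \<le> x" "x \<le> x1"
  shows "0 \<le> al + be * x"
proof (cases "0 \<le> be")
  case True
  then have "be * x0 \<le> be * x" using assms by (simp add: mult_left_mono)
  with assms show ?thesis by simp
next
  case False
  then have "be * x1 \<le> be * x" using assms by (simp add: mult_left_mono_neg)
  with assms show ?thesis by simp
qed

text \<open>If the \<open>2\<times>2\<close> system is singular with \<open>C \<noteq> 0\<close>, its solutions form a line over all \<open>x\<close>, and the
  candidate is the largest \<open>x \<le> r\<close> at which that line still lies in the region. If \<open>C = 0\<close>, no index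
  is active, so every point of the region will do.\<close>

definition candidate ::
  "real \<Rightarrow> real \<Rightarrow> real \<Rightarrow> real \<Rightarrow> real \<Rightarrow> real \<Rightarrow> real \<Rightarrow> real \<Rightarrow> real \<Rightarrow> real \<Rightarrow> real \<Rightarrow> real \<Rightarrow> real \<times> real" where
  "candidate A B C d1 d2 ic sl ic' sl' r m key =
    (if C = 0 then (m, key) else
      let x = (if A * C - B * B = 0
               then clip (ic' - d2 / C) (B / C - sl') (clip (d2 / C - ic) (sl - B / C) r)
               else (C * d1 - B * d2) / (A * C - B * B))
      in (x, (d2 - B * x) / C))"

text \<open>The solution \<open>x0, z0\<close> is only a witness and does not enter the computation
  of the candidate. Its mere existence in the region makes the candidate correct, so a rejected
  candidate certifies that the region has no solution.\<close>

lemma candidate_complete: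
  assumes x0: "l \<le> x0" "x0 \<le> r" and z0: "ic - x0 * sl \<le> z0" "z0 \<le> ic' - x0 * sl'"
    and eq: "A * x0 + B * z0 = d1" "B * x0 + C * z0 = d2"
    and singular: "C = 0 \<Longrightarrow> A = 0 \<and> B = 0"
    and m: "l \<le> m" "m \<le> r" "ic - m * sl = key" "key \<le> ic' - m * sl'"
    and xz: "candidate A B C d1 d2 ic sl ic' sl' r m key = (x, z)"
  shows "l \<le> x \<and> x \<le> r \<and> ic - x * sl \<le> z \<and> z \<le> ic' - x * sl' \<and>
    A * x + B * z = d1 \<and> B * x + C * z = d2"
proof (cases "C = 0")
  case True
  \<comment> \<open>The zero matrix together with the witness forces \<open>d1 = d2 = 0\<close>, so
    every point solves the system; the one returned is the point of the lower line over
    \<open>m\<close>.\<close>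
  with xz singular eq m show ?thesis by (auto simp: candidate_def)
next
  case C: False
  show ?thesis
  proof (cases "A * C - B * B = 0")
    case False
    have "C * d1 - B * d2 = (A * C - B * B) * x0" unfolding eq[symmetric] by (simp add: algebra_simps)
    with False have "(C * d1 - B * d2) / (A * C - B * B) = x0" by simp
    with False C xz have x: "x = x0" and z: "z = (d2 - B * x0) / C"
      by (auto simp: candidate_def Let_def)
    from C have "z = z0" unfolding z eq(2)[symmetric] by simp
    with x x0 z0 eq show ?thesis by simp
  next
    case True
    define x1 where "x1 = clip (d2 / C - ic) (sl - B / C) r"
    from True C xz have x: "x = clip (ic' - d2 / C) (B / C - sl') x1" and z: "z = (d2 - B * x) / C"
      by (auto simp: candidate_def Let_def x1_def)
    \<comment> \<open>Along the solution line of the second equation, the distances to the two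
      bounding lines are affine in the first coordinate, which is the form that \<open>clip\<close>
      takes.\<close>
    have lower: "z' - (ic - x' * sl) = (d2 / C - ic) + (sl - B / C) * x'"
      and upper: "(ic' - x' * sl') - z' = (ic' - d2 / C) + (B / C - sl') * x'"
      if "z' = (d2 - B * x') / C" for x' z'
      unfolding that by (simp_all add: diff_divide_distrib algebra_simps)
    have z0': "z0 = (d2 - B * x0) / C" using C unfolding eq(2)[symmetric] by simp
    have 0: "0 \<le> (d2 / C - ic) + (sl - B / C) * x0" "0 \<le> (ic' - d2 / C) + (B / C - sl') * x0"
      using lower[OF z0'] upper[OF z0'] z0 by linarith+
    note 1 = clip_props[OF 0(1) x0(2), folded x1_def]
    note 2 = clip_props[OF 0(2) 1(1), folded x]
    \<comment> \<open>The second clip moves left from \<open>x1\<close> but not beyond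
      \<open>x0\<close>. The first constraint holds at both of these points, hence also between
      them.\<close>
    have "0 \<le> (d2 / C - ic) + (sl - B / C) * x"
      by (rule affine_nonneg_between[OF 0(1) 1(3) 2(1,2)])
    with 2(3) lower[OF z] upper[OF z] have "ic - x * sl \<le> z" "z \<le> ic' - x * sl'" by linarith+
    moreover have "l \<le> x" "x \<le> r" using 1 2 x0 by linarith+
    moreover have Cz: "B * x + C * z = d2" using C by (simp add: z)
    moreover have "A * x + B * z = d1"
    proof -
      have sing: "A * C = B * B" using True by simp
      \<comment> \<open>The rows are dependent and the witness makes the system consistent, so the
        first equation follows from the second after multiplying by \<open>C\<close>.\<close>
      have "C * (A * x + B * z) = (A * C) * x + B * (C * z)" by (simp add: algebra_simps)
      also have "\<dots> = B * d2" unfolding sing Cz[symmetric] by (simp add: algebra_simps)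
      also have "\<dots> = (B * B) * x0 + B * C * z0" unfolding eq(2)[symmetric] by (simp add: algebra_simps)
      also have "\<dots> = C * d1" unfolding sing[symmetric] eq(1)[symmetric] by (simp add: algebra_simps)
      finally show ?thesis using C by simp
    qed
    ultimately show ?thesis by simp
  qed
qed

definition is_zero :: "rexp \<Rightarrow> bexp" where
  "is_zero e = BAnd (BNot (RLess e (RConst 0))) (BNot (RLess (RConst 0) e))"

lemma is_zero_simps [simp]:
  "bval (is_zero e) s \<longleftrightarrow> rval e s = 0" "bcost (is_zero e) = 2 * rcost e + 7"
  by (auto simp: is_zero_def)

definition clip_com :: com where
  "clip_com = Cond (BAnd (RLess (RVar ''be'') (RConst 0))
       (RLess (RDiv (RSub (RConst 0) (RVar ''al'')) (RVar ''be'')) (RVar ''x'')))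
     (RAssign ''x'' (RDiv (RSub (RConst 0) (RVar ''al'')) (RVar ''be''))) Skip"

definition candidate_com :: com where
  "candidate_com = Cond (is_zero (RVar ''C''))
    (Seq (RAssign ''x'' (RVar ''m'')) (RAssign ''z'' (RArr ''key'' (NVar ''e''))))
    (Seq (RAssign ''det'' (RSub (RMul (RVar ''A'') (RVar ''C'')) (RMul (RVar ''B'') (RVar ''B''))))
    (Seq (Cond (is_zero (RVar ''det''))
      (Seq (RAssign ''x'' (RVar ''r''))
      (Seq (RAssign ''al'' (RSub (RDiv (RVar ''d2'') (RVar ''C'')) (RArr ''ic'' (NVar ''e''))))
      (Seq (RAssign ''be'' (RSub (RArr ''sl'' (NVar ''e'')) (RDiv (RVar ''B'') (RVar ''C''))))
      (Seq clip_com
      (Seq (RAssign ''al'' (RSub (RArr ''ic'' (NVar ''g'')) (RDiv (RVar ''d2'') (RVar ''C''))))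
      (Seq (RAssign ''be'' (RSub (RDiv (RVar ''B'') (RVar ''C'')) (RArr ''sl'' (NVar ''g''))))
      clip_com))))))
      (RAssign ''x'' (RDiv (RSub (RMul (RVar ''C'') (RVar ''d1'')) (RMul (RVar ''B'') (RVar ''d2''))) (RVar ''det''))))
    (RAssign ''z'' (RDiv (RSub (RVar ''d2'') (RMul (RVar ''B'') (RVar ''x''))) (RVar ''C'')))))"

lemma clip_com_runI:
  assumes "\<And>t. t \<le> 20 \<Longrightarrow>
    Q t (s\<lparr>rvar := (rvar s)(''x'' := clip (rvar s ''al'') (rvar s ''be'') (rvar s ''x''))\<rparr>)"
  shows "run clip_com s Q"
proof -
  have "s\<lparr>rvar := rvar s\<rparr> = s" by (cases s) simp
  then show ?thesis using assms by (auto simp: clip_com_def clip_def)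
qed

lemma candidate_com_run:
  "run candidate_com s0 (\<lambda>t s. t \<le> 150 \<and> nvar s = nvar s0 \<and> narr s = narr s0 \<and> rarr s = rarr s0 \<and>
    agree_except {''x'', ''z'', ''det'', ''al'', ''be''} (rvar s) (rvar s0) \<and>
    candidate (rvar s0 ''A'') (rvar s0 ''B'') (rvar s0 ''C'') (rvar s0 ''d1'') (rvar s0 ''d2'')
      (rarr s0 ''ic'' (nvar s0 ''e'')) (rarr s0 ''sl'' (nvar s0 ''e''))
      (rarr s0 ''ic'' (nvar s0 ''g'')) (rarr s0 ''sl'' (nvar s0 ''g''))
      (rvar s0 ''r'') (rvar s0 ''m'') (rarr s0 ''key'' (nvar s0 ''e'')) = (rvar s ''x'', rvar s ''z''))"
proof (cases "rvar s0 ''C'' = 0")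
  case True
  then show ?thesis by (simp add: candidate_com_def candidate_def)
next
  case C: False
  show ?thesis
  proof (cases "rvar s0 ''A'' * rvar s0 ''C'' - rvar s0 ''B'' * rvar s0 ''B'' = 0")
    case True
    with C show ?thesis
      unfolding candidate_com_def
      apply (simp add: candidate_def)
      apply (rule clip_com_runI, simp)
      apply (rule clip_com_runI, simp add: Let_def)
      done
  next
    case False
    with C show ?thesis
      by (simp add: candidate_com_def candidate_def Let_def)
  qed
qed

section \<open>The program\<close>

definition init_body :: com where
  "init_body =
    Seq (RStore ''ic'' (NVar ''k'') (RDiv (RSub (RArr ''y'' (NVar ''k'')) (RConst 1)) (RArr ''w2'' (NVar ''k''))))
    (Seq (RStore ''ic'' (NAdd (NVar ''n'') (NVar ''k''))
      (RDiv (RAdd (RArr ''y'' (NVar ''k'')) (RConst 1)) (RArr ''w2'' (NVar ''k''))))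
    (Seq (RStore ''sl'' (NVar ''k'') (RDiv (RArr ''w1'' (NVar ''k'')) (RArr ''w2'' (NVar ''k''))))
    (Seq (RStore ''sl'' (NAdd (NVar ''n'') (NVar ''k'')) (RDiv (RArr ''w1'' (NVar ''k'')) (RArr ''w2'' (NVar ''k''))))
    (Seq (RStore ''wt'' (NVar ''k'') (RMul (RArr ''w2'' (NVar ''k'')) (RArr ''w2'' (NVar ''k''))))
    (Seq (RStore ''wt'' (NAdd (NVar ''n'') (NVar ''k''))
      (RSub (RConst 0) (RMul (RArr ''w2'' (NVar ''k'')) (RArr ''w2'' (NVar ''k'')))))
    (Seq (RStore ''key'' (NVar ''k'')
      (RSub (RDiv (RSub (RArr ''y'' (NVar ''k'')) (RConst 1)) (RArr ''w2'' (NVar ''k'')))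
        (RMul (RVar ''m'') (RDiv (RArr ''w1'' (NVar ''k'')) (RArr ''w2'' (NVar ''k''))))))
    (Seq (RStore ''key'' (NAdd (NVar ''n'') (NVar ''k''))
      (RSub (RDiv (RAdd (RArr ''y'' (NVar ''k'')) (RConst 1)) (RArr ''w2'' (NVar ''k'')))
        (RMul (RVar ''m'') (RDiv (RArr ''w1'' (NVar ''k'')) (RArr ''w2'' (NVar ''k''))))))
    (Seq (NStore ''a'' (NVar ''k'') (NVar ''k''))
    (Seq (NStore ''a'' (NAdd (NVar ''n'') (NVar ''k'')) (NAdd (NVar ''n'') (NVar ''k'')))
    (Seq (RAssign ''d1'' (RAdd (RVar ''d1'') (RArr ''w1'' (NVar ''k''))))
    (Seq (RAssign ''d2'' (RAdd (RVar ''d2'') (RArr ''w2'' (NVar ''k''))))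
    (incr ''k''))))))))))))"

text \<open>The loop counter \<open>k\<close> and the moments \<open>A\<close>, \<open>B\<close>,
  \<open>C\<close> get no assignment: they start at the zeros that the input state
  guarantees.\<close>

definition init_com :: com where
  "init_com =
    Seq (NAssign ''N'' (NAdd (NVar ''n'') (NVar ''n'')))
    (Seq (RAssign ''m'' (RDiv (RAdd (RVar ''l'') (RVar ''r'')) (RConst 2)))
    (Seq (RAssign ''d1'' (RSub (RConst 0) (RVar ''c1'')))
    (Seq (RAssign ''d2'' (RSub (RConst 0) (RVar ''c2'')))
    (While (NLess (NVar ''k'') (NVar ''n'')) init_body))))"

definition accumulate_com :: com where
  "accumulate_com =
    Seq (NAssign ''e'' (NArr ''a'' (NVar ''k'')))
    (Seq (NAssign ''g'' (NArr ''a'' (NAdd (NVar ''k'') (NConst 1))))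
    (Seq (RAssign ''A'' (RAdd (RVar ''A'') (RMul (RMul (RArr ''wt'' (NVar ''e'')) (RArr ''sl'' (NVar ''e''))) (RArr ''sl'' (NVar ''e'')))))
    (Seq (RAssign ''B'' (RAdd (RVar ''B'') (RMul (RArr ''wt'' (NVar ''e'')) (RArr ''sl'' (NVar ''e'')))))
    (Seq (RAssign ''C'' (RAdd (RVar ''C'') (RArr ''wt'' (NVar ''e''))))
    (Seq (RAssign ''d1'' (RAdd (RVar ''d1'') (RMul (RMul (RArr ''wt'' (NVar ''e'')) (RArr ''sl'' (NVar ''e''))) (RArr ''ic'' (NVar ''e'')))))
    (RAssign ''d2'' (RAdd (RVar ''d2'') (RMul (RArr ''wt'' (NVar ''e'')) (RArr ''ic'' (NVar ''e''))))))))))"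

definition check_exp :: bexp where
  "check_exp =
    BAnd (BNot (RLess (RVar ''x'') (RVar ''l'')))
    (BAnd (BNot (RLess (RVar ''r'') (RVar ''x'')))
    (BAnd (BNot (RLess (RVar ''z'') (RSub (RArr ''ic'' (NVar ''e'')) (RMul (RVar ''x'') (RArr ''sl'' (NVar ''e''))))))
    (BAnd (BNot (RLess (RSub (RArr ''ic'' (NVar ''g'')) (RMul (RVar ''x'') (RArr ''sl'' (NVar ''g'')))) (RVar ''z'')))
    (BAnd (is_zero (RSub (RAdd (RMul (RVar ''A'') (RVar ''x'')) (RMul (RVar ''B'') (RVar ''z''))) (RVar ''d1'')))
      (is_zero (RSub (RAdd (RMul (RVar ''B'') (RVar ''x'')) (RMul (RVar ''C'') (RVar ''z''))) (RVar ''d2'')))))))"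

text \<open>The sweep does not stop at a hit. A later region may overwrite the answer, but only with
  a point that has passed the same check.\<close>

definition record_com :: com where
  "record_com = Seq (Cond check_exp
      (Seq (RAssign ''lambda1'' (RVar ''x'')) (RAssign ''lambda2'' (RVar ''z''))) Skip)
    (incr ''k'')"

definition sweep_com :: com where
  "sweep_com = Seq (NAssign ''k'' (NConst 0))
    (While (NLess (NAdd (NVar ''k'') (NConst 1)) (NVar ''N''))
      (Seq accumulate_com (Seq candidate_com record_com)))"

definition solve_com :: com where
  "solve_com = Seq init_com (Seq sort_com sweep_com)"

section \<open>Correctness and running time of the program on an instance\<close>

context strip_instance
begin

text \<open>Each round of the initial loop writes the cells \<open>k\<close> and
  \<open>n + k\<close>, so two separate prefixes grow at the same pace.\<close>

definition filled :: "(nat \<Rightarrow> 'a) \<Rightarrow> (nat \<Rightarrow> 'a) \<Rightarrow> nat \<Rightarrow> bool" where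
  "filled ar g k \<longleftrightarrow> (\<forall>i<k. ar i = g i \<and> ar (n + i) = g (n + i))"

lemma filled_Suc:
  "filled ar g k \<Longrightarrow> k < n \<Longrightarrow> u = g k \<Longrightarrow> v = g (n + k) \<Longrightarrow> filled (ar(k := u, n + k := v)) g (Suc k)"
  by (auto simp: filled_def less_Suc_eq)

lemma filled_n: "filled ar g n \<Longrightarrow> e < n + n \<Longrightarrow> ar e = g e"
  unfolding filled_def by (cases "e < n") (auto dest: spec[of _ "e - n"])

definition loaded :: "state \<Rightarrow> nat \<Rightarrow> bool" where
  "loaded s k \<longleftrightarrow> filled (rarr s ''ic'') ic k \<and> filled (rarr s ''sl'') sl k \<and> filled (rarr s ''wt'') wt k \<and>
    filled (rarr s ''key'') (\<lambda>e. F e mid) k"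

lemma event_values:
  assumes "i < n"
  shows "ic i = (y i - 1) / w 2 i" "ic (n + i) = (y i + 1) / w 2 i"
    "sl i = w 1 i / w 2 i" "sl (n + i) = w 1 i / w 2 i"
    "wt i = w 2 i * w 2 i" "wt (n + i) = - (w 2 i * w 2 i)"
  using assms by (simp_all add: ic_def sl_def wt_def sgn_of_def ix_def power2_eq_square)

abbreviation input :: state where "input \<equiv> input_state n y w c1 c2 l r"

lemma init_com_run:
  "run init_com input (\<lambda>t s. t \<le> 200 * n + 50 \<and> loaded s n \<and> filled (narr s ''a'') id n \<and>
    nvar s ''N'' = n + n \<and> rvar s ''l'' = l \<and> rvar s ''r'' = r \<and> rvar s ''m'' = mid \<and>
    rvar s ''A'' = 0 \<and> rvar s ''B'' = 0 \<and> rvar s ''C'' = 0 \<and>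
    rvar s ''d1'' = d1 {} \<and> rvar s ''d2'' = d2 {})"
proof -
  let ?X = "{''ic'', ''sl'', ''wt'', ''key''}"
  define s1 where "s1 = input\<lparr>nvar := (nvar input)(''N'' := n + n),
    rvar := (rvar input)(''m'' := mid, ''d1'' := - c1, ''d2'' := - c2)\<rparr>"
  define I where "I m s \<longleftrightarrow> m = n - nvar s ''k'' \<and> nvar s ''k'' \<le> n \<and>
    agree_except {''k''} (nvar s) (nvar s1) \<and> agree_except {''d1'', ''d2''} (rvar s) (rvar s1) \<and>
    agree_except ?X (rarr s) (rarr s1) \<and> loaded s (nvar s ''k'') \<and> filled (narr s ''a'') id (nvar s ''k'') \<and>
    rvar s ''d1'' = (\<Sum>i<nvar s ''k''. w 1 i) - c1 \<and> rvar s ''d2'' = (\<Sum>i<nvar s ''k''. w 2 i) - c2"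
    for m and s :: state
  let ?b = "NLess (NVar ''k'') (NVar ''n'')"
  have "run (While ?b init_body) s1 (\<lambda>t s. (\<exists>m. I m s) \<and> \<not> bval ?b s \<and>
      t \<le> n * (180 + 1 + bcost ?b) + 1 + bcost ?b)"
  proof (rule run_While_count, goal_cases)
    case 1
    show ?case by (simp add: I_def s1_def input_state_def loaded_def filled_def)
  next
    case (2 m s)
    let ?k = "nvar s ''k''"
    from 2(1) have m: "m = n - ?k" and ag: "agree_except {''k''} (nvar s) (nvar s1)"
      "agree_except {''d1'', ''d2''} (rvar s) (rvar s1)" "agree_except ?X (rarr s) (rarr s1)"
      and loaded: "loaded s ?k" "filled (narr s ''a'') id ?k"
      and d: "rvar s ''d1'' = (\<Sum>i<?k. w 1 i) - c1" "rvar s ''d2'' = (\<Sum>i<?k. w 2 i) - c2"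
      by (simp_all add: I_def)
    have n: "nvar s ''n'' = n" using agree_exceptD[OF ag(1), of "''n''"] by (simp add: s1_def input_state_def)
    with 2(2) have k: "?k < n" by simp
    have v: "rvar s ''m'' = mid" "rarr s ''y'' ?k = y ?k" "rarr s ''w1'' ?k = w 1 ?k" "rarr s ''w2'' ?k = w 2 ?k"
      using agree_exceptD[OF ag(2), of "''m''"] agree_exceptD[OF ag(3), of "''y''"]
        agree_exceptD[OF ag(3), of "''w1''"] agree_exceptD[OF ag(3), of "''w2''"] k
      by (simp_all add: s1_def input_state_def)
    show ?case
      using k loaded ag d m unfolding init_body_def
      by (simp add: I_def n v loaded_def filled_Suc F_def event_values)
  qed
  then have "run (While ?b init_body) s1 (\<lambda>t s. t \<le> 200 * n + 10 \<and> loaded s n \<and> filled (narr s ''a'') id n \<and>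
    nvar s ''N'' = n + n \<and> rvar s ''l'' = l \<and> rvar s ''r'' = r \<and> rvar s ''m'' = mid \<and>
    rvar s ''A'' = 0 \<and> rvar s ''B'' = 0 \<and> rvar s ''C'' = 0 \<and>
    rvar s ''d1'' = d1 {} \<and> rvar s ''d2'' = d2 {})"
  proof (rule run_mono, goal_cases)
    case (1 t s)
    then obtain m where I: "I m s" by blast
    then have ag: "agree_except {''k''} (nvar s) (nvar s1)" "agree_except {''d1'', ''d2''} (rvar s) (rvar s1)"
      by (simp_all add: I_def)
    have "nvar s ''n'' = n" using agree_exceptD[OF ag(1), of "''n''"] by (simp add: s1_def input_state_def)
    with 1 I have k: "nvar s ''k'' = n" by (simp add: I_def)
    have "rvar s ''l'' = l" "rvar s ''r'' = r" "rvar s ''m'' = mid"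
      "rvar s ''A'' = 0" "rvar s ''B'' = 0" "rvar s ''C'' = 0"
      using agree_exceptD[OF ag(2), of "''l''"] agree_exceptD[OF ag(2), of "''r''"] agree_exceptD[OF ag(2), of "''m''"]
        agree_exceptD[OF ag(2), of "''A''"] agree_exceptD[OF ag(2), of "''B''"] agree_exceptD[OF ag(2), of "''C''"]
      by (simp_all add: s1_def input_state_def)
    moreover have "nvar s ''N'' = n + n"
      using agree_exceptD[OF ag(1), of "''N''"] by (simp add: s1_def)
    moreover have "t \<le> 200 * n + 10" using 1 by simp
    ultimately show ?case using I unfolding I_def k by (simp add: d1_def d2_def)
  qed
  then show ?thesis
    unfolding init_com_def
    by (simp add: input_state_def s1_def mid_def) (auto elim!: run_mono)
qed

lemma processed_Suc:
  assumes "event_order a" "k < n + n"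
  shows "(\<Sum>e\<in>a ` {..<Suc k}. g e) = (\<Sum>e\<in>a ` {..<k}. g e) + (g (a k) :: real)"
proof -
  have "a k \<notin> a ` {..<k}"
    using inj_on_image_mem_iff[OF a_inj[OF assms(1)], of k "{..<k}"] assms(2) by auto
  then show ?thesis by (simp add: lessThan_Suc)
qed

definition sweep_state :: "(nat \<Rightarrow> nat) \<Rightarrow> nat set \<Rightarrow> state \<Rightarrow> bool" where
  "sweep_state a P s \<longleftrightarrow> loaded s n \<and> narr s ''a'' = a \<and> nvar s ''N'' = n + n \<and>
    rvar s ''l'' = l \<and> rvar s ''r'' = r \<and> rvar s ''m'' = mid \<and>
    rvar s ''A'' = mA P \<and> rvar s ''B'' = mB P \<and> rvar s ''C'' = mC P \<and>
    rvar s ''d1'' = d1 P \<and> rvar s ''d2'' = d2 P"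

lemma sweep_state_cong:
  assumes "sweep_state a P s" "rarr s' = rarr s" "narr s' = narr s" "nvar s' ''N'' = nvar s ''N''"
    "agree_except X (rvar s') (rvar s)" "X \<inter> {''l'', ''r'', ''m'', ''A'', ''B'', ''C'', ''d1'', ''d2''} = {}"
  shows "sweep_state a P s'"
  using assms unfolding sweep_state_def loaded_def agree_except_def by (auto simp: disjoint_iff)

lemma loaded_values:
  assumes "loaded s n" "e < n + n"
  shows "rarr s ''ic'' e = ic e" "rarr s ''sl'' e = sl e" "rarr s ''wt'' e = wt e" "rarr s ''key'' e = F e mid"
  using assms filled_n unfolding loaded_def by blast+

lemma accumulate_com_run:
  assumes ord: "event_order a" and st: "sweep_state a (a ` {..<k}) s0"
    and k: "nvar s0 ''k'' = k" "Suc k < n + n"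
  shows "run accumulate_com s0 (\<lambda>t s. t \<le> 80 \<and> sweep_state a (a ` {..<Suc k}) s \<and>
    nvar s ''k'' = k \<and> nvar s ''e'' = a k \<and> nvar s ''g'' = a (Suc k) \<and>
    rvar s ''lambda1'' = rvar s0 ''lambda1'' \<and> rvar s ''lambda2'' = rvar s0 ''lambda2'')"
proof -
  have "loaded s0 n" using st by (simp add: sweep_state_def)
  note vals = loaded_values[OF this a_less[OF ord, of k]]
  have sums: "mA (a ` {..<Suc k}) = mA (a ` {..<k}) + wt (a k) * sl (a k) * sl (a k)"
    "mB (a ` {..<Suc k}) = mB (a ` {..<k}) + wt (a k) * sl (a k)"
    "mC (a ` {..<Suc k}) = mC (a ` {..<k}) + wt (a k)"
    "d1 (a ` {..<Suc k}) = d1 (a ` {..<k}) + wt (a k) * sl (a k) * ic (a k)"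
    "d2 (a ` {..<Suc k}) = d2 (a ` {..<k}) + wt (a k) * ic (a k)"
    unfolding mA_def mB_def mC_def d1_def d2_def using k by (simp_all add: processed_Suc[OF ord] del: lessThan_Suc)
  show ?thesis
    using st k vals by (simp add: accumulate_com_def sweep_state_def loaded_def sums del: lessThan_Suc image_Suc_lessThan)
qed

text \<open>Conditional on purpose: until a region with a solution has been passed, nothing is
  claimed about the output cells.\<close>

definition found_upto :: "(nat \<Rightarrow> nat) \<Rightarrow> nat \<Rightarrow> state \<Rightarrow> bool" where
  "found_upto a k s \<longleftrightarrow>
    ((\<exists>k'<k. \<exists>x z. region a k' x z \<and> is_solution n y w c1 c2 (x, z)) \<longrightarrow>
     is_solution n y w c1 c2 (result s))"

lemma candidate_region:
  assumes ord: "event_order a" and k: "Suc k < n + n" and sol: "region a k x0 z0" "is_solution n y w c1 c2 (x0, z0)"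
  defines "P \<equiv> a ` {..<Suc k}"
  assumes xz: "candidate (mA P) (mB P) (mC P) (d1 P) (d2 P) (ic (a k)) (sl (a k)) (ic (a (Suc k))) (sl (a (Suc k)))
      r mid (F (a k) mid) = (x, z)"
  shows "region a k x z \<and> is_solution n y w c1 c2 (x, z)"
proof -
  have eq: "mA P * x0 + mB P * z0 = d1 P" "mB P * x0 + mC P * z0 = d2 P"
    using region_is_solution[OF ord k sol(1)] sol(2) unfolding P_def by simp_all
  have reg: "l \<le> x0" "x0 \<le> r" "ic (a k) - x0 * sl (a k) \<le> z0" "z0 \<le> ic (a (Suc k)) - x0 * sl (a (Suc k))"
    using sol(1) by (simp_all add: region_def F_def)
  have singular: "mA P = 0 \<and> mB P = 0" if "mC P = 0"
    using singular_moments[OF processed_subset[OF ord] processed_closed[OF ord], of "Suc k"] k that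
    unfolding P_def by simp
  have m: "l \<le> mid" "mid \<le> r" using mid_in by simp_all
  have "F (a k) mid \<le> ic (a (Suc k)) - mid * sl (a (Suc k))"
    using a_mono[OF ord _ k m, of k] by (simp add: F_def)
  from candidate_complete[OF reg eq singular m _ this xz]
  have res: "l \<le> x \<and> x \<le> r \<and> ic (a k) - x * sl (a k) \<le> z \<and> z \<le> ic (a (Suc k)) - x * sl (a (Suc k)) \<and>
    mA P * x + mB P * z = d1 P \<and> mB P * x + mC P * z = d2 P"
    by (simp add: F_def)
  then have "region a k x z" by (simp add: region_def F_def)
  with region_is_solution[OF ord k this] res show ?thesis unfolding P_def by blast
qed

lemma check_exp_iff:
  assumes ord: "event_order a" and st: "sweep_state a (a ` {..<Suc k}) s" and k: "Suc k < n + n"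
    and eg: "nvar s ''e'' = a k" "nvar s ''g'' = a (Suc k)"
  shows "bval check_exp s \<longleftrightarrow>
    region a k (rvar s ''x'') (rvar s ''z'') \<and> is_solution n y w c1 c2 (rvar s ''x'', rvar s ''z'')"
proof -
  have "loaded s n" using st by (simp add: sweep_state_def)
  note vals = loaded_values[OF this a_less[OF ord k]] loaded_values[OF this a_less[OF ord, of k]]
  let ?x = "rvar s ''x''" and ?z = "rvar s ''z''" and ?P = "a ` {..<Suc k}"
  have "bval check_exp s \<longleftrightarrow> region a k ?x ?z \<and>
      mA ?P * ?x + mB ?P * ?z = d1 ?P \<and> mB ?P * ?x + mC ?P * ?z = d2 ?P"
    using st vals k eg
    by (auto simp: check_exp_def sweep_state_def region_def F_def not_less simp del: lessThan_Suc)
  then show ?thesis using region_is_solution[OF ord k] by blast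
qed

lemma sweep_step:
  assumes ord: "event_order a" and st: "sweep_state a (a ` {..<k}) s0" and found: "found_upto a k s0"
    and k: "nvar s0 ''k'' = k" "Suc k < n + n"
  shows "run (Seq accumulate_com (Seq candidate_com record_com)) s0 (\<lambda>t s. t \<le> 400 \<and>
    sweep_state a (a ` {..<Suc k}) s \<and> found_upto a (Suc k) s \<and> nvar s ''k'' = Suc k)"
proof (rule run_SeqI[OF accumulate_com_run[OF ord st k]], goal_cases)
  case (1 t1 s1)
  let ?P = "a ` {..<Suc k}"
  from 1 have st1: "sweep_state a ?P s1" and eg1: "nvar s1 ''e'' = a k" "nvar s1 ''g'' = a (Suc k)"
    and k1: "nvar s1 ''k'' = k" and lam1: "result s1 = result s0" and t1: "t1 \<le> 80"
    by (simp_all add: result_def)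
  have "loaded s1 n" using st1 by (simp add: sweep_state_def)
  note vals = loaded_values[OF this a_less[OF ord k(2)]] loaded_values[OF this a_less[OF ord, of k]]
  show ?case
  proof (rule run_SeqI[OF candidate_com_run], goal_cases)
    case (1 t2 s2)
    then have t2: "t2 \<le> 150" and same: "nvar s2 = nvar s1" "narr s2 = narr s1" "rarr s2 = rarr s1"
      and ag: "agree_except {''x'', ''z'', ''det'', ''al'', ''be''} (rvar s2) (rvar s1)"
      by simp_all
    have cand: "candidate (mA ?P) (mB ?P) (mC ?P) (d1 ?P) (d2 ?P) (ic (a k)) (sl (a k))
        (ic (a (Suc k))) (sl (a (Suc k))) r mid (F (a k) mid) = (rvar s2 ''x'', rvar s2 ''z'')"
      using 1 vals st1 eg1 k(2) unfolding sweep_state_def by simp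
    have st2: "sweep_state a ?P s2"
      by (rule sweep_state_cong[OF st1 _ _ _ ag]) (simp_all add: same)
    have eg2: "nvar s2 ''e'' = a k" "nvar s2 ''g'' = a (Suc k)" and k2: "nvar s2 ''k'' = k"
      using eg1 k1 same by simp_all
    have lam2: "result s2 = result s0"
      using agree_exceptD[OF ag, of "''lambda1''"] agree_exceptD[OF ag, of "''lambda2''"] lam1 by (simp add: result_def)
    note check = check_exp_iff[OF ord st2 k(2) eg2]
    have cost: "bcost check_exp \<le> 90" by (simp add: check_exp_def)
    show ?case
    proof (cases "bval check_exp s2")
      case True
      let ?s = "s2\<lparr>rvar := (rvar s2)(''lambda1'' := rvar s2 ''x'', ''lambda2'' := rvar s2 ''z''),
        nvar := (nvar s2)(''k'' := Suc k)\<rparr>"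
      have "sweep_state a ?P ?s"
        by (rule sweep_state_cong[OF st2, where X = "{''lambda1'', ''lambda2''}"]) simp_all
      moreover have "found_upto a (Suc k) ?s"
        using True check by (simp add: found_upto_def result_def)
      ultimately show ?thesis
        using True t1 t2 cost k2 by (simp add: record_com_def)
    next
      case False
      let ?s = "s2\<lparr>nvar := (nvar s2)(''k'' := Suc k)\<rparr>"
      have "sweep_state a ?P ?s"
        by (rule sweep_state_cong[OF st2, where X = "{}"]) simp_all
      moreover have "found_upto a (Suc k) ?s"
      proof -
        \<comment> \<open>Completeness of the candidate read backwards: the check failed, so region
          \<open>k\<close> has no solution and the claim for the earlier regions carries
          over.\<close>
        have "\<not> (region a k x z \<and> is_solution n y w c1 c2 (x, z))" for x z
          using False check candidate_region[OF ord k(2) _ _ cand] by blast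
        with found lam2 show ?thesis by (auto simp: found_upto_def result_def less_Suc_eq)
      qed
      ultimately show ?thesis
        using False t1 t2 cost k2 by (simp add: record_com_def)
    qed
  qed
qed

lemma sweep_com_run:
  assumes ord: "event_order a" and st: "sweep_state a {} s0"
  shows "run sweep_com s0 (\<lambda>t s. t \<le> 900 * n + 20 \<and> is_solution n y w c1 c2 (result s))"
proof -
  define I where "I m s \<longleftrightarrow> m = n + n - nvar s ''k'' \<and> (nvar s ''k'' = 0 \<or> nvar s ''k'' < n + n) \<and>
    sweep_state a (a ` {..<nvar s ''k''}) s \<and> found_upto a (nvar s ''k'') s" for m and s :: state
  let ?b = "NLess (NAdd (NVar ''k'') (NConst 1)) (NVar ''N'')"
  define s1 where "s1 = s0\<lparr>nvar := (nvar s0)(''k'' := 0)\<rparr>"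
  have "run (While ?b (Seq accumulate_com (Seq candidate_com record_com))) s1
      (\<lambda>t s. (\<exists>m. I m s) \<and> \<not> bval ?b s \<and> t \<le> (n + n) * (400 + 1 + bcost ?b) + 1 + bcost ?b)"
  proof (rule run_While_count, goal_cases)
    case 1
    have "sweep_state a {} s1"
      by (rule sweep_state_cong[OF st, where X = "{}"]) (simp_all add: s1_def)
    then show ?case by (simp add: I_def s1_def found_upto_def)
  next
    case (2 m s)
    then have st: "sweep_state a (a ` {..<nvar s ''k''}) s" and found: "found_upto a (nvar s ''k'') s"
      and m: "m = n + n - nvar s ''k''" by (simp_all add: I_def)
    from st have "nvar s ''N'' = n + n" by (simp add: sweep_state_def)
    with 2(2) have k: "Suc (nvar s ''k'') < n + n" by simp
    show ?case
    proof (intro conjI run_mono[OF sweep_step[OF ord st found refl k]])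
      show "0 < m" using m k by simp
    qed (use m k in \<open>simp_all add: I_def\<close>)
  qed
  then have "run (While ?b (Seq accumulate_com (Seq candidate_com record_com))) s1
      (\<lambda>t s. t \<le> 900 * n + 15 \<and> is_solution n y w c1 c2 (result s))"
  proof (rule run_mono, goal_cases)
    case (1 t s)
    then obtain m where I: "I m s" by blast
    let ?k = "nvar s ''k''"
    have "nvar s ''N'' = n + n" using I by (simp add: I_def sweep_state_def)
    with 1 have k: "n + n \<le> Suc ?k" by simp
    have "is_solution n y w c1 c2 (result s)"
    proof (cases "n = 0")
      case True
      \<comment> \<open>Without indices \<open>h\<close> is identically zero; the existing solution
        yields \<open>c1 = c2 = 0\<close>, so every point is a solution.\<close>
      from ex_solution show ?thesis unfolding is_solution_def h_def True by simp
    next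
      case False
      then obtain k' x z where "Suc k' < n + n" "region a k' x z" "is_solution n y w c1 c2 (x, z)"
        using ex_region_solution[OF ord] by blast
      \<comment> \<open>There is one region fewer than there are lines: the loop exits with
        \<open>n + n \<le> Suc ?k\<close>, which already covers every \<open>k'\<close> with
        \<open>Suc k' < n + n\<close>.\<close>
      moreover from this k have "k' < ?k" by simp
      ultimately show ?thesis using I unfolding I_def found_upto_def by blast
    qed
    then show ?case using 1 by simp
  qed
  then show ?thesis
    unfolding sweep_com_def s1_def by (auto elim!: run_mono)
qed

text \<open>The array \<open>b\<close> is the initial identity, so the multiset equation says that
  \<open>a\<close> lists every event exactly once.\<close>

lemma event_order_sorted:
  assumes "sorted (map f (slice a 0 (n + n)))" "mset (slice a 0 (n + n)) = mset (slice b 0 (n + n))"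
    and f: "\<And>e. e < n + n \<Longrightarrow> f e = F e mid" and b: "\<And>e. e < n + n \<Longrightarrow> b e = e"
  shows "event_order a"
proof -
  let ?N = "n + n"
  have "slice b 0 ?N = [0..<?N]" using b by (intro map_idI) simp
  with assms(2) have m: "mset (slice a 0 ?N) = mset [0..<?N]" by (simp only:)
  from mset_eq_setD[OF m] have img: "a ` {..<?N} = {..<?N}" by (simp add: atLeast0LessThan)
  moreover have "distinct (slice a 0 ?N)" using mset_eq_imp_distinct_iff[OF m] by simp
  then have "inj_on a {..<?N}" by (simp add: distinct_map atLeast0LessThan)
  ultimately have "bij_betw a {..<?N} {..<?N}" by (simp add: bij_betw_def)
  moreover have "F (a p) mid \<le> F (a q) mid" if "p \<le> q" "q < ?N" for p q
  proof -
    have "map f (slice a 0 ?N) ! p \<le> map f (slice a 0 ?N) ! q"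
      using assms(1) that by (intro sorted_nth_mono) simp_all
    then have "f (a p) \<le> f (a q)" using that by simp
    moreover have "a p < ?N" "a q < ?N" using img that by auto
    ultimately show ?thesis using f by simp
  qed
  ultimately show ?thesis unfolding event_order_def by blast
qed

lemma solve_com_run:
  assumes L: "n + n \<le> 2 ^ L"
  shows "run solve_com input (\<lambda>t s. t \<le> 2000 * (n + 1) * (L + 1) \<and> is_solution n y w c1 c2 (result s))"
  unfolding solve_com_def
proof (rule run_SeqI[OF init_com_run], goal_cases)
  case (1 t1 s1)
  then have t1: "t1 \<le> 200 * n + 50" and loaded: "loaded s1 n" "filled (narr s1 ''a'') id n"
    and N: "nvar s1 ''N'' = n + n" by simp_all
  from L N have L': "nvar s1 ''N'' \<le> 2 ^ L" by simp
  show ?case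
  proof (rule run_SeqI[OF sort_com_run[OF L']], goal_cases)
    case (1 t2 s2)
    then have t2: "t2 \<le> L * (220 * (n + n) + 50) + 20" and same: "rvar s2 = rvar s1" "rarr s2 = rarr s1"
      and ag: "agree_except {''i'', ''j'', ''k'', ''lo'', ''mid'', ''hi'', ''wd''} (nvar s2) (nvar s1)"
      and srt: "sorted (map (rarr s1 ''key'') (slice (narr s2 ''a'') 0 (n + n)))"
        "mset (slice (narr s2 ''a'') 0 (n + n)) = mset (slice (narr s1 ''a'') 0 (n + n))"
      unfolding N by simp_all
    have ord: "event_order (narr s2 ''a'')"
      using event_order_sorted[OF srt] loaded_values(4)[OF loaded(1)] filled_n[OF loaded(2)] by simp
    have "sweep_state (narr s2 ''a'') {} s2"
      using \<open>t1 \<le> 200 * n + 50 \<and> _\<close> same agree_exceptD[OF ag, of "''N''"]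
      by (simp add: sweep_state_def loaded_def mA_def mB_def mC_def)
    then show ?case
    proof (rule run_mono[OF sweep_com_run[OF ord]], goal_cases)
      case (1 t3 s3)
      \<comment> \<open>Both sides are expanded so that \<open>L * n\<close> becomes a single
        unknown and the comparison is linear.\<close>
      have "2000 * (n + 1) * (L + 1) = 2000 * (L * n) + 2000 * L + 2000 * n + 2000" by (simp add: algebra_simps)
      moreover have "L * (220 * (n + n) + 50) = 440 * (L * n) + 50 * L" by (simp add: algebra_simps)
      ultimately show ?case using 1 t1 t2 by simp
    qed
  qed
qed

end

text \<open>The number of merge passes needed for \<open>n + n\<close> lines, hence the logarithm of
  the doubled argument.\<close>

definition log2_up :: "nat \<Rightarrow> nat" where
  "log2_up n = nat \<lceil>log 2 (real (n + n))\<rceil>"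

lemma le_power_log2_up: "n + n \<le> 2 ^ log2_up n"
proof (cases "n = 0")
  case False
  then have "real (n + n) = 2 powr log 2 (real (n + n))" by simp
  also have "\<dots> \<le> 2 powr real (log2_up n)"
    unfolding log2_up_def by (intro powr_mono real_nat_ceiling_ge) simp
  also have "\<dots> = real (2 ^ log2_up n)" by (simp add: powr_realpow)
  finally show ?thesis by (simp only: of_nat_le_iff)
qed simp

lemma time_bound_bigo:
  "(\<lambda>n. real (2000 * (n + 1) * (log2_up n + 1))) \<in> O(\<lambda>n. real n * ln (real n))"
\<comment> \<open>From \<open>n = 2\<close> on, \<open>n + 1\<close> is at most \<open>2 * n\<close>
  and the binary logarithm of \<open>n\<close> is at least 1. Doubling the argument, rounding up and
  the final \<open>+ 1\<close> add at most 3 to it, which gives a factor 4; in total 2000 times 2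
  times 4.\<close>
proof (rule bigoI[where c = "16000 / ln 2"], rule eventually_mono[OF eventually_ge_at_top[of 2]])
  fix n :: nat assume n: "2 \<le> n"
  have ln2: "0 < ln (2::real)" by simp
  have lnn: "ln 2 \<le> ln (real n)" using n by simp
  have "log 2 (real (n + n)) = ln (real n) / ln 2 + 1"
    using n by (simp add: log_def ln_mult field_simps flip: mult_2)
  moreover have "0 \<le> log 2 (real (n + n))" using n by simp
  ultimately have "real (log2_up n) \<le> ln (real n) / ln 2 + 2" unfolding log2_up_def by linarith
  moreover have "1 \<le> ln (real n) / ln 2" using lnn by simp
  ultimately have log: "real (log2_up n + 1) \<le> 4 * (ln (real n) / ln 2)"
    unfolding of_nat_add of_nat_1 by linarith
  have "real (2000 * (n + 1) * (log2_up n + 1)) = 2000 * real (n + 1) * real (log2_up n + 1)"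
    by (simp only: of_nat_mult of_nat_numeral)
  also have "\<dots> \<le> 2000 * (2 * real n) * (4 * (ln (real n) / ln 2))"
    using n log by (intro mult_mono) simp_all
  finally show "norm (real (2000 * (n + 1) * (log2_up n + 1))) \<le> 16000 / ln 2 * norm (real n * ln (real n))"
    using lnn ln2 by (simp add: field_simps)
qed

theorem mainTheorem7:
  "\<exists>(P :: com) (T :: nat \<Rightarrow> nat).
     (\<lambda>n. real (T n)) \<in> O(\<lambda>n. real n * ln (real n)) \<and>
     (\<forall>(n :: nat) (y :: nat \<Rightarrow> real) (w :: nat \<Rightarrow> nat \<Rightarrow> real)
        (c1 :: real) (c2 :: real) (l :: real) (r :: real).
        (\<forall>i<n. w 1 i \<ge> 0) \<longrightarrow>
        (\<forall>i<n. w 2 i > 0) \<longrightarrow>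
        l < r \<longrightarrow>
        (\<exists>lam. is_solution n y w c1 c2 lam \<and> fst lam \<in> {l<..<r}) \<longrightarrow>
        (\<forall>p. intersection_point n y w p \<longrightarrow> fst p \<notin> {l<..<r}) \<longrightarrow>
        (\<exists>t s. exec P (input_state n y w c1 c2 l r) t s \<and> t \<le> T n \<and>
               is_solution n y w c1 c2 (result s)))"
proof (intro exI[of _ solve_com] exI[of _ "\<lambda>n. 2000 * (n + 1) * (log2_up n + 1)"] conjI allI impI)
  show "(\<lambda>n. real (2000 * (n + 1) * (log2_up n + 1))) \<in> O(\<lambda>n. real n * ln (real n))"
    by (rule time_bound_bigo)
next
  fix n y w c1 c2 l r
  assume "\<forall>i<n. w 2 i > 0" "l < r" "\<exists>lam. is_solution n y w c1 c2 lam \<and> fst lam \<in> {l<..<r}"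
    "\<forall>p. intersection_point n y w p \<longrightarrow> fst p \<notin> {l<..<r}"
  then interpret strip_instance n y w c1 c2 l r by unfold_locales auto
  show "\<exists>t s. exec solve_com (input_state n y w c1 c2 l r) t s \<and> t \<le> 2000 * (n + 1) * (log2_up n + 1) \<and>
      is_solution n y w c1 c2 (result s)"
    using solve_com_run[OF le_power_log2_up] unfolding run_def by blast
qed

end
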